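(* Let $G$ be a connected graph and let $\mathcal{B}$ be the family of cycles in $G$ that are bigons. Then geodesics in $G$ are stable if and only if there exist constants $\varepsilon>0$ and $k,m\in\mathbb{N}$ such that $G$ is $\varepsilon$-densely $(k,m)$-chordal on $\mathcal{B}$.
   Context: Every edge of the connected graph $G$ has length $1$, interior points of edges are points of $G$, and $d$ is the induced shortest-path (length) metric on $G$, making $G$ a geodesic metric space. Geodesics are stable in a geodesic metric space $(X,d)$ if there is a constant $R\ge0$ such that, for any two points $x,y\in X$ and any geodesic $[xy]$, every geodesic $\sigma$ joining $x$ to $y$ satisfies $d_H(\sigma,[xy])\le R$, where $d_H$ is the Hausdorff distance. A bigon is a geodesic triangle with two identical vertices, i.e. the union of two geodesics joining the same pair of points $x,y$ of $G$ (points not necessarily vertices). Paths are finite and simple. A cycle is a simple closed curve, given by a sequence of vertices all different except that the first and last coincide. $L(\cdot)$ denotes length. For a cycle $C$, $d_C$ denotes the length metric on $C$. A shortcut in $C$ is a path $\sigma$ in $G$ joining two vertices $p,q$ of $C$ with $L(\sigma)<d_C(p,q)$; it is strict if $\sigma\cap C=\{p,q\}$, and then $p,q$ are the shortcut vertices associated to $\sigma$. A subset $A$ of a metric space $(X,\rho)$ is $\varepsilon$-dense if for every $x\in X$ there is $a\in A$ with $\rho(a,x)<\varepsilon$. Given a family $\mathcal{F}$ of cycles, $G$ is $\varepsilon$-densely $(k,m)$-chordal on $\mathcal{F}$ if for every $C\in\mathcal{F}$ with $L(C)\ge k$ there exist strict shortcuts $\sigma_1,\dots,\sigma_r$ in $C$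 with $L(\sigma_i)\le m$ for all $i$ whose associated shortcut vertices form an $\varepsilon$-dense subset of $(C,d_C)$. It is always assumed that $k\ge4$ and $k\ge 2m$. *)

theory Defs
  imports Complex_Main "HOL-Library.Indicator_Function"
begin

section \<open>Simple graphs, paths and cycles\<close>

text \<open>Graphs are simple and undirected, and may be infinite and not locally finite.\<close>

definition walk :: "'a set \<Rightarrow> 'a set set \<Rightarrow> 'a list \<Rightarrow> bool" where
  "walk V E vs \<longleftrightarrow> vs \<noteq> [] \<and> set vs \<subseteq> V \<and> successively (\<lambda>u v. {u, v} \<in> E) vs"

definition vertex_path :: "'a set \<Rightarrow> 'a set set \<Rightarrow> 'a list \<Rightarrow> bool" where
  "vertex_path V E vs \<longleftrightarrow> walk V E vs \<and> distinct vs"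

text \<open>The first vertex of a cycle is repeated at the end; four entries (three edges) are
  needed for the closed curve to be simple.\<close>

definition vertex_cycle :: "'a set \<Rightarrow> 'a set set \<Rightarrow> 'a list \<Rightarrow> bool" where
  "vertex_cycle V E vs \<longleftrightarrow> walk V E vs \<and> 4 \<le> length vs \<and> hd vs = last vs \<and> distinct (tl vs)"

definition walk_edges :: "'a list \<Rightarrow> 'a set set" where
  "walk_edges vs = {{vs ! i, vs ! Suc i} | i. Suc i < length vs}"

definition walk_length :: "'a list \<Rightarrow> nat" where
  "walk_length vs = length vs - 1"

locale connected_graph =
  fixes V :: "'a set" and E :: "'a set set"
  assumes edges: "e \<in> E \<Longrightarrow> e \<subseteq> V \<and> card e = 2"
    and connected: "u \<in> V \<Longrightarrow> v \<in> V \<Longrightarrow> \<exists>vs. vertex_path V E vs \<and> hd vs = u \<and> last vs = v"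


section \<open>Graphs as metric spaces\<close>

text \<open>Points are given by barycentric coordinates: the point at distance \<open>t\<close> from \<open>u\<close>
  on the edge \<open>{u, v}\<close> has coordinate \<open>1 - t\<close> at \<open>u\<close>, \<open>t\<close> at \<open>v\<close>, and \<open>0\<close> elsewhere.\<close>

definition vertex_point :: "'a \<Rightarrow> ('a \<Rightarrow> real)" where
  "vertex_point v = indicator {v}"

definition edge_points :: "'a set \<Rightarrow> ('a \<Rightarrow> real) set" where
  "edge_points e = {p. (\<forall>w. 0 \<le> p w) \<and> (\<forall>w. w \<notin> e \<longrightarrow> p w = 0) \<and> (\<Sum>w\<in>e. p w) = 1}"

definition graph_points :: "'a set \<Rightarrow> 'a set set \<Rightarrow> ('a \<Rightarrow> real) set" where
  "graph_points V E = vertex_point ` V \<union> (\<Union>e\<in>E. edge_points e)"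

text \<open>\<open>linked V E p q l\<close>: the points \<open>p\<close> and \<open>q\<close> are joined by a piecewise linear curve of
  length \<open>l\<close>. Two points of the edge \<open>{u, v}\<close> at parameters \<open>s\<close> and \<open>t\<close> differ
  by \<open>\<bar>s - t\<bar>\<close> in each of their two coordinates, whence the factor \<open>1 / 2\<close>.\<close>

inductive linked ::
  "'a set \<Rightarrow> 'a set set \<Rightarrow> ('a \<Rightarrow> real) \<Rightarrow> ('a \<Rightarrow> real) \<Rightarrow> real \<Rightarrow> bool"
  for V E where
  refl: "p \<in> graph_points V E \<Longrightarrow> linked V E p p 0"
| step: "\<lbrakk>e \<in> E; p \<in> edge_points e; q \<in> edge_points e; linked V E q r l\<rbrakk>
    \<Longrightarrow> linked V E p r ((\<Sum>w\<in>e. \<bar>p w - q w\<bar>) / 2 + l)"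

text \<open>The length metric; the infimum is over a nonempty set whenever the graph is connected.\<close>

definition graph_dist :: "'a set \<Rightarrow> 'a set set \<Rightarrow> ('a \<Rightarrow> real) \<Rightarrow> ('a \<Rightarrow> real) \<Rightarrow> real" where
  "graph_dist V E p q = Inf {l. linked V E p q l}"

text \<open>The subset of the graph traced out by a path or cycle, and, for a cycle \<open>C\<close>, its
  length metric, which is the length metric of \<open>C\<close> regarded as a graph itself.\<close>

definition trace :: "'a list \<Rightarrow> ('a \<Rightarrow> real) set" where
  "trace vs = graph_points (set vs) (walk_edges vs)"

definition cycle_dist :: "'a list \<Rightarrow> ('a \<Rightarrow> real) \<Rightarrow> ('a \<Rightarrow> real) \<Rightarrow> real" where
  "cycle_dist C = graph_dist (set C) (walk_edges C)"


section \<open>Geodesics and their stability\<close>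

definition geodesic :: "'p set \<Rightarrow> ('p \<Rightarrow> 'p \<Rightarrow> real) \<Rightarrow> 'p \<Rightarrow> 'p \<Rightarrow> 'p set \<Rightarrow> bool" where
  "geodesic X d x y S \<longleftrightarrow>
     (\<exists>\<gamma>. \<gamma> 0 = x \<and> \<gamma> (d x y) = y \<and> \<gamma> ` {0..d x y} = S \<and> S \<subseteq> X \<and>
       (\<forall>s\<in>{0..d x y}. \<forall>t\<in>{0..d x y}. d (\<gamma> s) (\<gamma> t) = \<bar>s - t\<bar>))"

text \<open>Meaningful as a real number for nonempty bounded sets, such as geodesics.\<close>

definition hausdorff_dist :: "('p \<Rightarrow> 'p \<Rightarrow> real) \<Rightarrow> 'p set \<Rightarrow> 'p set \<Rightarrow> real" where
  "hausdorff_dist d A B =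
     max (SUP a\<in>A. INF b\<in>B. d a b) (SUP b\<in>B. INF a\<in>A. d a b)"

definition stable_geodesics :: "'p set \<Rightarrow> ('p \<Rightarrow> 'p \<Rightarrow> real) \<Rightarrow> bool" where
  "stable_geodesics X d \<longleftrightarrow>
     (\<exists>R\<ge>0. \<forall>x\<in>X. \<forall>y\<in>X. \<forall>S T. geodesic X d x y S \<and> geodesic X d x y T \<longrightarrow>
       hausdorff_dist d T S \<le> R)"

definition bigon :: "'p set \<Rightarrow> ('p \<Rightarrow> 'p \<Rightarrow> real) \<Rightarrow> 'p set \<Rightarrow> bool" where
  "bigon X d B \<longleftrightarrow>
     (\<exists>x\<in>X. \<exists>y\<in>X. \<exists>S T. geodesic X d x y S \<and> geodesic X d x y T \<and> B = S \<union> T)"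

definition bigon_cycles :: "'a set \<Rightarrow> 'a set set \<Rightarrow> 'a list set" where
  "bigon_cycles V E =
     {C. vertex_cycle V E C \<and> bigon (graph_points V E) (graph_dist V E) (trace C)}"


section \<open>Shortcuts and dense chordality\<close>

definition shortcut :: "'a set \<Rightarrow> 'a set set \<Rightarrow> 'a list \<Rightarrow> 'a list \<Rightarrow> bool" where
  "shortcut V E C \<sigma> \<longleftrightarrow> vertex_path V E \<sigma> \<and> hd \<sigma> \<in> set C \<and> last \<sigma> \<in> set C \<and>
     real (walk_length \<sigma>) < cycle_dist C (vertex_point (hd \<sigma>)) (vertex_point (last \<sigma>))"

definition shortcut_vertices :: "'a list \<Rightarrow> ('a \<Rightarrow> real) set" where
  "shortcut_vertices \<sigma> = {vertex_point (hd \<sigma>), vertex_point (last \<sigma>)}"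

definition strict_shortcut :: "'a set \<Rightarrow> 'a set set \<Rightarrow> 'a list \<Rightarrow> 'a list \<Rightarrow> bool" where
  "strict_shortcut V E C \<sigma> \<longleftrightarrow>
     shortcut V E C \<sigma> \<and> trace \<sigma> \<inter> trace C = shortcut_vertices \<sigma>"

definition dense_subset :: "real \<Rightarrow> 'p set \<Rightarrow> ('p \<Rightarrow> 'p \<Rightarrow> real) \<Rightarrow> 'p set \<Rightarrow> bool" where
  "dense_subset \<epsilon> X d A \<longleftrightarrow> A \<subseteq> X \<and> (\<forall>x\<in>X. \<exists>a\<in>A. d a x < \<epsilon>)"

definition densely_chordal_on ::
  "'a set \<Rightarrow> 'a set set \<Rightarrow> real \<Rightarrow> nat \<Rightarrow> nat \<Rightarrow> 'a list set \<Rightarrow> bool" where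
  "densely_chordal_on V E \<epsilon> k m F \<longleftrightarrow>
     (\<forall>C\<in>F. k \<le> walk_length C \<longrightarrow>
       (\<exists>\<Sigma>. finite \<Sigma> \<and> (\<forall>\<sigma>\<in>\<Sigma>. strict_shortcut V E C \<sigma> \<and> walk_length \<sigma> \<le> m) \<and>
         dense_subset \<epsilon> (trace C) (cycle_dist C) (\<Union>\<sigma>\<in>\<Sigma>. shortcut_vertices \<sigma>)))"

end

theory Submission
  imports Defs
begin

text \<open>
  Both directions rest on one picture of a bigon cycle: a simple closed curve \<open>C\<close> made of two
  geodesics \<open>\<alpha>\<close> and \<open>\<beta>\<close> of length \<open>L\<close> with common ends. Along one side nothing can be cut
  short: the metric of \<open>C\<close> and that of the graph agree on each side
  (\<open>cycle_dist_isometric_path\<close>), because they agree locally. The sides meet only in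
  the two ends (\<open>sides_inter\<close>): the distance from \<open>\<alpha> 0\<close> takes each value at most once
  on each side, so a further common point would be the only point of \<open>C\<close> on its level and would
  separate \<open>C\<close>, whereas a cycle minus a point is connected. Hence every curve in \<open>C\<close> from one side
  to the other passes through an end.

  \<^bold>\<open>Chordality implies stability.\<close> Let \<open>p = \<alpha> s\<close>. If \<open>\<alpha> s \<noteq> \<beta> s\<close>, take the maximal
  parameter interval around \<open>s\<close> on which the geodesics differ. If it is short, \<open>p\<close> is close to the
  point where they meet. Otherwise the two pieces form a cycle (\<open>bigon_cycle_exists\<close>), which is a
  bigon, and it is long. By density some shortcut has an end within \<open>\<epsilon>\<close> of \<open>p\<close>. Its
  ends are not on the same side, for a path between them on that side is already geodesic. So
  one of the two ends, at distance at most \<open>\<epsilon> + m\<close> from \<open>p\<close>, is on the other side.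

  \<^bold>\<open>Stability implies chordality.\<close> Let \<open>R\<close> be the stability constant. A vertex \<open>a\<close> on one side
  of a long bigon cycle is joined by a walk of length less than \<open>R + 2\<close> to a vertex on the other side.
  If \<open>a\<close> is far from both ends, a piece of this walk that leaves the first side and
  first reaches the second has ends which are far apart in \<open>C\<close>, for in \<open>C\<close> one has to travel to
  an end of the bigon; so it is a strict shortcut (\<open>strict_shortcut_near\<close>). Points near the
  ends are at bounded distance from such vertices \<open>a\<close>, whence density (\<open>dense_shortcuts\<close>).

  What remains is to pass between continuous geodesics and lists of vertices. A point is a
  family of barycentric coordinates, and its coordinates control the metric: each is
  1-Lipschitz, and \<open>1 - p a\<close> is the distance from \<open>p\<close> to a vertex \<open>a\<close> of its edge.
\<close>

section \<open>Points on edges\<close>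

definition on_edge :: "'a \<Rightarrow> 'a \<Rightarrow> real \<Rightarrow> ('a \<Rightarrow> real)" where
  "on_edge u v t = (\<lambda>w. (1 - t) * vertex_point u w + t * vertex_point v w)"

text \<open>The contribution of a single step to the length of a curve in \<open>linked\<close>.\<close>

definition edge_dist :: "'a set \<Rightarrow> ('a \<Rightarrow> real) \<Rightarrow> ('a \<Rightarrow> real) \<Rightarrow> real" where
  "edge_dist e p q = (\<Sum>w\<in>e. \<bar>p w - q w\<bar>) / 2"

lemmas linked_edge_induct [consumes 1, case_names refl step] =
  linked.induct [folded edge_dist_def]

lemma vertex_point_apply: "vertex_point u w = (if w = u then 1 else 0)"
  by (simp add: vertex_point_def indicator_def)

lemma vertex_point_eq_iff [simp]: "vertex_point u = vertex_point v \<longleftrightarrow> u = v"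
  by (metis vertex_point_apply zero_neq_one)

lemma on_edge_0 [simp]: "on_edge u v 0 = vertex_point u"
  and on_edge_1 [simp]: "on_edge u v 1 = vertex_point v"
  by (simp_all add: on_edge_def)

lemma on_edge_commute: "on_edge u v t = on_edge v u (1 - t)"
  by (auto simp: on_edge_def)

lemma on_edge_left [simp]: "u \<noteq> v \<Longrightarrow> on_edge u v t u = 1 - t"
  and on_edge_right [simp]: "u \<noteq> v \<Longrightarrow> on_edge u v t v = t"
  and on_edge_other: "w \<noteq> u \<Longrightarrow> w \<noteq> v \<Longrightarrow> on_edge u v t w = 0"
  by (simp_all add: on_edge_def vertex_point_apply)

lemma on_edge_mem:
  assumes "u \<noteq> v" "0 \<le> t" "t \<le> 1"
  shows "on_edge u v t \<in> edge_points {u, v}"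
  using assms unfolding edge_points_def
  by (auto simp: on_edge_def vertex_point_apply)

lemma edge_points_eq_on_edge:
  assumes "u \<noteq> v" "p \<in> edge_points {u, v}"
  shows "p = on_edge u v (p v)" "0 \<le> p v" "p v \<le> 1" "p u = 1 - p v"
proof -
  have s: "p u + p v = 1" and pos: "\<And>w. 0 \<le> p w"
    and z: "\<And>w. w \<notin> {u, v} \<Longrightarrow> p w = 0"
    using assms by (auto simp: edge_points_def)
  show "0 \<le> p v" "p u = 1 - p v" using s pos by auto
  show "p v \<le> 1" using s pos[of u] by linarith
  show "p = on_edge u v (p v)"
  proof
    fix w
    show "p w = on_edge u v (p v) w"
      using s z[of w] assms(1) on_edge_other[of w u v "p v"] by (cases "w = u"; cases "w = v") simp_all
  qed
qed

lemma edge_points_image: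
  assumes "u \<noteq> v"
  shows "edge_points {u, v} = on_edge u v ` {0..1}"
  using edge_points_eq_on_edge[OF assms] on_edge_mem[OF assms] by fastforce

lemma edge_dist_on_edge:
  assumes "u \<noteq> v"
  shows "edge_dist {u, v} (on_edge u v s) (on_edge u v t) = \<bar>s - t\<bar>"
  using assms by (simp add: edge_dist_def)

lemma edge_points_pos_mem: "p \<in> edge_points e \<Longrightarrow> p a > 0 \<Longrightarrow> a \<in> e"
  by (force simp: edge_points_def)

lemma edge_dist_triangle: "edge_dist e p r \<le> edge_dist e p q + edge_dist e q r"
proof -
  have "(\<Sum>w\<in>e. \<bar>p w - r w\<bar>) \<le> (\<Sum>w\<in>e. \<bar>p w - q w\<bar> + \<bar>q w - r w\<bar>)"
    by (rule sum_mono) linarith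
  then show ?thesis by (simp add: edge_dist_def sum.distrib)
qed

lemma edge_dist_commute: "edge_dist e p q = edge_dist e q p"
  by (simp add: edge_dist_def abs_minus_commute)

lemma edge_dist_nonneg [simp]: "0 \<le> edge_dist e p q"
  by (simp add: edge_dist_def sum_nonneg)

lemma edge_dist_refl [simp]: "edge_dist e p p = 0"
  by (simp add: edge_dist_def)

lemma edge_points_le_one:
  assumes "card e = 2" "p \<in> edge_points e"
  shows "p w \<le> 1"
proof -
  obtain u v where "u \<noteq> v" "e = {u, v}" using assms(1) by (meson card_2_iff)
  then have "p \<in> edge_points {u, v}" "0 \<le> p v" "p v \<le> 1" "p u = 1 - p v"
    using edge_points_eq_on_edge(2-4)[of u v p] assms(2) by blast+
  moreover have "p w = 0 \<or> w = u \<or> w = v"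
    using calculation(1) by (auto simp: edge_points_def)
  ultimately show ?thesis by (elim disjE) auto
qed

text \<open>On an edge the two coordinates change by opposite amounts, so half the sum of the changes is
  each one of them.\<close>

lemma coordinate_le_edge_dist:
  assumes "card e = 2" "p \<in> edge_points e" "q \<in> edge_points e"
  shows "\<bar>p w - q w\<bar> \<le> edge_dist e p q"
proof -
  obtain u v where uv: "u \<noteq> v" "e = {u, v}" using assms(1) by (meson card_2_iff)
  have p': "p \<in> edge_points {u, v}" and q': "q \<in> edge_points {u, v}" using uv assms by auto
  have "edge_dist e p q = \<bar>p v - q v\<bar>"
    using edge_dist_on_edge[OF uv(1), of "p v" "q v"] uv(2)
    by (simp flip: edge_points_eq_on_edge(1)[OF uv(1) p'] edge_points_eq_on_edge(1)[OF uv(1) q'])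
  moreover have "p u = 1 - p v" "q u = 1 - q v"
    using edge_points_eq_on_edge(4)[OF uv(1)] p' q' by auto
  moreover have "p w = 0 \<and> q w = 0 \<or> w = u \<or> w = v"
    using assms uv by (auto simp: edge_points_def)
  ultimately show ?thesis by (elim disjE) auto
qed

lemma vertex_point_mem_edge:
  assumes "card e = 2" "a \<in> e"
  shows "vertex_point a \<in> edge_points e"
proof -
  obtain u v where uv: "u \<noteq> v" "e = {u, v}" using assms(1) by (meson card_2_iff)
  then show ?thesis using assms(2) on_edge_mem[of u v 0] on_edge_mem[of u v 1] by auto
qed

lemma card_2_other:
  assumes "card e = 2" "a \<in> e"
  obtains b where "b \<noteq> a" "e = {b, a}"
proof -
  obtain u v where "u \<noteq> v" "e = {u, v}" using assms(1) by (meson card_2_iff)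
  then show ?thesis using that[of u] that[of v] assms(2) by (auto simp: insert_commute)
qed

lemma edge_dist_vertex_point:
  assumes "card e = 2" "a \<in> e" "p \<in> edge_points e"
  shows "edge_dist e p (vertex_point a) = 1 - p a"
proof -
  obtain b where b: "b \<noteq> a" "e = {b, a}"
    using card_2_other assms(1,2) .
  have p': "p \<in> edge_points {b, a}" using b assms by simp
  show ?thesis using edge_dist_on_edge[OF b(1), of "p a" 1] b(2) edge_points_eq_on_edge(3)[OF b(1) p']
    by (simp flip: edge_points_eq_on_edge(1)[OF b(1) p'])
qed

lemma edge_points_eq_vertex_point:
  assumes "card e = 2" "p \<in> edge_points e" "p a = 1"
  shows "p = vertex_point a"
proof -
  have "a \<in> e" using assms edge_points_pos_mem[of p e a] by simp
  then obtain b where b: "b \<noteq> a" "e = {b, a}"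
    by (rule card_2_other[OF assms(1)])
  then show ?thesis using edge_points_eq_on_edge(1)[of b a p] assms by simp
qed

lemma edge_points_eq_opposite_vertex:
  assumes "a \<noteq> b" "p \<in> edge_points {a, b}" "p a = 0"
  shows "p = vertex_point b"
  using edge_points_eq_on_edge[OF assms(1,2)] assms(3) by (metis on_edge_1 right_minus_eq)

text \<open>Two positive coordinates determine the edge of a point, so a point on two edges has only
  one of them.\<close>

lemma edge_points_inter:
  assumes "card e = 2" "card f = 2" "e \<noteq> f" "p \<in> edge_points e" "p \<in> edge_points f"
  shows "\<exists>a. p = vertex_point a \<and> a \<in> e \<and> a \<in> f"
proof -
  obtain u v where uv: "u \<noteq> v" "e = {u, v}" using assms(1) by (meson card_2_iff)
  have "p u = 0 \<or> p v = 0"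
  proof (rule ccontr)
    assume "\<not> ?thesis"
    then have "p u > 0" "p v > 0" using assms(4) by (auto simp: edge_points_def less_le)
    then have "{u, v} \<subseteq> f"
      using edge_points_pos_mem[OF assms(5), of u] edge_points_pos_mem[OF assms(5), of v] by simp
    moreover have "finite f" using assms(2) card.infinite by force
    ultimately have "{u, v} = f" using card_subset_eq[of f "{u, v}"] uv(2) assms(1,2) by simp
    then show False using uv(2) assms(3) by simp
  qed
  then obtain a where a: "p = vertex_point a" "a \<in> e"
    using edge_points_eq_opposite_vertex[of u v p] edge_points_eq_opposite_vertex[of v u p] uv assms(4)
    by (auto simp: insert_commute)
  moreover have "a \<in> f" using a edge_points_pos_mem[OF assms(5), of a] by (simp add: vertex_point_apply)
  ultimately show ?thesis by blast
qed

section \<open>The length metric\<close>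

context connected_graph
begin

lemma edgeE:
  assumes "e \<in> E"
  obtains u v where "e = {u, v}" "u \<noteq> v" "u \<in> V" "v \<in> V"
  using edges[OF assms] by (auto simp: card_2_iff)

lemma edge_neq: "{u, v} \<in> E \<Longrightarrow> u \<noteq> v"
  using edges[of "{u, v}"] by auto

lemma edge_verts: "{u, v} \<in> E \<Longrightarrow> u \<in> V \<and> v \<in> V"
  using edges[of "{u, v}"] by auto

lemma edge_card: "e \<in> E \<Longrightarrow> card e = 2"
  using edges by blast

lemma vertex_point_in_points [simp]: "vertex_point v \<in> graph_points V E \<longleftrightarrow> v \<in> V"
proof
  assume "vertex_point v \<in> graph_points V E"
  then show "v \<in> V"
    using edge_points_pos_mem[of "vertex_point v" _ v] edges
    by (force simp: graph_points_def vertex_point_apply)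
qed (simp add: graph_points_def)

lemma edge_points_subset: "e \<in> E \<Longrightarrow> edge_points e \<subseteq> graph_points V E"
  by (auto simp: graph_points_def)

lemma graph_pointsE:
  assumes "p \<in> graph_points V E"
  obtains v where "v \<in> V" "p = vertex_point v" | e where "e \<in> E" "p \<in> edge_points e"
  using assms by (auto simp: graph_points_def)

lemma graph_points_coordinate:
  assumes "p \<in> graph_points V E"
  shows "0 \<le> p w" "p w \<le> 1"
  using assms edge_points_le_one[OF edge_card, of _ p w]
  by (auto elim!: graph_pointsE simp: vertex_point_apply edge_points_def)

lemma graph_points_eq_vertex_point:
  assumes "p \<in> graph_points V E" "p a = 1"
  shows "p = vertex_point a" "a \<in> V"
proof -
  show "p = vertex_point a"
    using assms edge_points_eq_vertex_point[OF edge_card]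
    by (auto elim!: graph_pointsE simp: vertex_point_apply split: if_splits)
  then show "a \<in> V" using assms by simp
qed

lemma linked_points:
  assumes "linked V E p q l"
  shows "p \<in> graph_points V E" "q \<in> graph_points V E" "0 \<le> l"
  using assms
proof (induction rule: linked_edge_induct)
  case (step e p q r l)
  { case 1 then show ?case using step edge_points_subset by auto }
  { case 2 then show ?case using step by simp }
  { case 3 then show ?case using step by simp }
qed auto

lemma linked_step:
  "e \<in> E \<Longrightarrow> p \<in> edge_points e \<Longrightarrow> q \<in> edge_points e \<Longrightarrow> linked V E q r l
    \<Longrightarrow> linked V E p r (edge_dist e p q + l)"
  unfolding edge_dist_def by (rule linked.step)

lemma linked_edge:
  assumes "e \<in> E" "p \<in> edge_points e" "q \<in> edge_points e"
  shows "linked V E p q (edge_dist e p q)"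
  using linked_step[OF assms linked.refl] edge_points_subset[OF assms(1)] assms(3) by auto

lemma linked_trans:
  assumes "linked V E p q l" "linked V E q r l'"
  shows "linked V E p r (l + l')"
  using assms
proof (induction rule: linked_edge_induct)
  case (step e p q r' l)
  then show ?case using linked_step[of e p q r "l + l'"] by (simp add: add.assoc)
qed simp

lemma linked_sym:
  assumes "linked V E p q l"
  shows "linked V E q p l"
  using assms
proof (induction rule: linked_edge_induct)
  case (step e p q r l)
  have "linked V E q p (edge_dist e q p)" using step linked_edge by blast
  from linked_trans[OF step.IH this] show ?case
    by (simp add: edge_dist_commute add.commute)
qed (rule linked.refl)

lemma linked_vertex_of_edge:
  assumes "e \<in> E" "p \<in> edge_points e" "a \<in> e"
  shows "linked V E p (vertex_point a) (1 - p a)"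
  using linked_edge[OF assms(1,2) vertex_point_mem_edge[OF edge_card[OF assms(1)] assms(3)]]
    edge_dist_vertex_point[OF edge_card[OF assms(1)] assms(3,2)] by simp

lemma linked_to_support:
  assumes "p \<in> graph_points V E" "p a > 0"
  shows "linked V E p (vertex_point a) (1 - p a)" "a \<in> V"
proof -
  have "linked V E p (vertex_point a) (1 - p a) \<and> a \<in> V"
    using assms(1)
  proof (cases rule: graph_pointsE)
    case (1 v)
    then have "v = a" using assms(2) by (auto simp: vertex_point_apply split: if_splits)
    then show ?thesis using 1 linked.refl[OF assms(1)] by (simp add: vertex_point_apply)
  next
    case (2 e)
    have "a \<in> e" using edge_points_pos_mem[OF 2(2) assms(2)] .
    then show ?thesis using linked_vertex_of_edge[OF 2] edges[OF 2(1)] by blast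
  qed
  then show "linked V E p (vertex_point a) (1 - p a)" "a \<in> V" by auto
qed

lemma linked_walk:
  assumes "walk V E vs"
  shows "linked V E (vertex_point (hd vs)) (vertex_point (last vs)) (real (walk_length vs))"
  using assms
proof (induction vs rule: induct_list012)
  case (2 v)
  then show ?case by (auto simp: walk_def walk_length_def intro: linked.refl)
next
  case (3 u v ws)
  then have uv: "{u, v} \<in> E" and w: "walk V E (v # ws)" by (auto simp: walk_def)
  have "linked V E (vertex_point u) (vertex_point v) 1"
    using linked_vertex_of_edge[OF uv vertex_point_mem_edge[OF edge_card[OF uv]], of u v]
      edge_neq[OF uv] by (simp add: vertex_point_apply)
  from linked_trans[OF this "3.IH"(2)[OF w, unfolded list.sel]] show ?case
    by (simp add: walk_length_def)
qed (simp add: walk_def)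

lemma support_nonempty:
  assumes "p \<in> graph_points V E"
  obtains v where "v \<in> V" "p v > 0"
  using assms
proof (cases rule: graph_pointsE)
  case (2 e)
  then obtain u v where uv: "e = {u, v}" "u \<noteq> v" "u \<in> V" "v \<in> V" using edgeE by metis
  then have "p u > 0 \<or> p v > 0" using edge_points_eq_on_edge(2,4)[of u v p] 2 by force
  then show ?thesis using that uv by blast
qed (use that in \<open>auto simp: vertex_point_apply\<close>)

lemma linked_exists:
  assumes "p \<in> graph_points V E" "q \<in> graph_points V E"
  shows "\<exists>l. linked V E p q l"
proof -
  obtain u where u: "p u > 0" "u \<in> V" using support_nonempty[OF assms(1)] by metis
  obtain v where v: "q v > 0" "v \<in> V" using support_nonempty[OF assms(2)] by metis
  obtain vs where "vertex_path V E vs" "hd vs = u" "last vs = v" using connected u v by blast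
  then have "\<exists>l. linked V E (vertex_point u) (vertex_point v) l"
    using linked_walk by (auto simp: vertex_path_def)
  then show ?thesis
    using linked_to_support[OF assms(1) u(1)] linked_sym[OF linked_to_support(1)[OF assms(2) v(1)]]
      linked_trans by meson
qed

abbreviation "X \<equiv> graph_points V E"
abbreviation "d \<equiv> graph_dist V E"

lemma dist_le_linked: "linked V E p q l \<Longrightarrow> d p q \<le> l"
  unfolding graph_dist_def by (rule cInf_lower) (auto intro: linked_points bdd_belowI[of _ 0])

lemma dist_less_linked:
  assumes "p \<in> X" "q \<in> X" "d p q < c"
  obtains l where "linked V E p q l" "l < c"
  using assms linked_exists[OF assms(1,2)] cInf_lessD[of "{l. linked V E p q l}" c]
  unfolding graph_dist_def by auto

lemma dist_ge:
  assumes "p \<in> X" "q \<in> X" "\<And>l. linked V E p q l \<Longrightarrow> c \<le> l"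
  shows "c \<le> d p q"
  by (meson assms dist_less_linked linorder_not_less)

lemma dist_nonneg: "p \<in> X \<Longrightarrow> q \<in> X \<Longrightarrow> 0 \<le> d p q"
  using dist_ge linked_points by blast

lemma dist_refl [simp]: "p \<in> X \<Longrightarrow> d p p = 0"
  using dist_nonneg[of p p] dist_le_linked[OF linked.refl] by force

lemma dist_commute: "d p q = d q p"
proof -
  have "{l. linked V E p q l} = {l. linked V E q p l}" using linked_sym by blast
  then show ?thesis by (simp add: graph_dist_def)
qed

lemma dist_triangle:
  assumes "p \<in> X" "q \<in> X" "r \<in> X"
  shows "d p r \<le> d p q + d q r"
proof (rule field_le_epsilon)
  fix c :: real assume "c > 0"
  then obtain l l' where "linked V E p q l" "l < d p q + c / 2" "linked V E q r l'" "l' < d q r + c / 2"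
    using dist_less_linked[OF assms(1,2), of "d p q + c/2"] dist_less_linked[OF assms(2,3), of "d q r + c/2"]
    by (metis half_gt_zero less_add_same_cancel1)
  then show "d p r \<le> d p q + d q r + c" using dist_le_linked[OF linked_trans] by fastforce
qed

text \<open>Coordinates are 1-Lipschitz on each edge, hence along curves. This is the source of
  lower bounds for the metric, and it is sharp for two points of one edge.\<close>

lemma linked_coordinate: "linked V E p q l \<Longrightarrow> \<bar>p w - q w\<bar> \<le> l"
proof (induction rule: linked_edge_induct)
  case (step e p q r l)
  then show ?case using coordinate_le_edge_dist[OF edge_card, of e p q w] by force
qed simp

lemma dist_coordinate: "p \<in> X \<Longrightarrow> q \<in> X \<Longrightarrow> \<bar>p w - q w\<bar> \<le> d p q"
  by (rule dist_ge[OF _ _ linked_coordinate])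

lemma dist_eq_0_iff: "p \<in> X \<Longrightarrow> q \<in> X \<Longrightarrow> d p q = 0 \<longleftrightarrow> p = q"
proof
  assume a: "p \<in> X" "q \<in> X" "d p q = 0"
  show "p = q"
  proof
    fix w show "p w = q w" using dist_coordinate[OF a(1,2), of w] a(3) by simp
  qed
qed simp

lemma on_edge_in_points:
  "{u, v} \<in> E \<Longrightarrow> 0 \<le> t \<Longrightarrow> t \<le> 1 \<Longrightarrow> on_edge u v t \<in> X"
  using on_edge_mem[of u v t] edge_neq[of u v] edge_points_subset[of "{u, v}"] by blast

lemma dist_on_edge:
  assumes "{u, v} \<in> E" "0 \<le> s" "s \<le> 1" "0 \<le> t" "t \<le> 1"
  shows "d (on_edge u v s) (on_edge u v t) = \<bar>s - t\<bar>"
proof (rule antisym)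
  have n: "u \<noteq> v" using assms edge_neq by auto
  show "d (on_edge u v s) (on_edge u v t) \<le> \<bar>s - t\<bar>"
    using dist_le_linked[OF linked_edge[OF assms(1) on_edge_mem[OF n] on_edge_mem[OF n]]]
      edge_dist_on_edge[OF n] assms by simp
  show "\<bar>s - t\<bar> \<le> d (on_edge u v s) (on_edge u v t)"
    using dist_coordinate[OF on_edge_in_points on_edge_in_points, of u v s u v t v] assms n by simp
qed

lemma dist_edge_points:
  assumes "e \<in> E" "p \<in> edge_points e" "q \<in> edge_points e"
  shows "d p q = edge_dist e p q"
proof -
  obtain u v where uv: "e = {u, v}" "u \<noteq> v" using edgeE assms by metis
  then have p': "p \<in> edge_points {u, v}" and q': "q \<in> edge_points {u, v}" using assms by auto
  show ?thesis
    using dist_on_edge[of u v "p v" "q v"] edge_dist_on_edge[of u v "p v" "q v"] uv assms(1)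
      edge_points_eq_on_edge(2,3)[OF uv(2) p'] edge_points_eq_on_edge(2,3)[OF uv(2) q']
    by (simp flip: edge_points_eq_on_edge(1)[OF uv(2) p'] edge_points_eq_on_edge(1)[OF uv(2) q'])
qed

lemma dist_to_support:
  assumes "p \<in> X" "p a > 0"
  shows "d p (vertex_point a) = 1 - p a"
proof (rule antisym)
  show "d p (vertex_point a) \<le> 1 - p a" using dist_le_linked[OF linked_to_support(1)[OF assms]] .
  show "1 - p a \<le> d p (vertex_point a)"
    using dist_coordinate[of p "vertex_point a" a] linked_to_support(2)[OF assms] assms
    by (simp add: vertex_point_apply)
qed

text \<open>Where a curve changes from one edge to another it is at a vertex \<open>a\<close>, and \<open>1 - p a\<close> is a
  lower bound for the length of a curve from \<open>p\<close> to \<open>a\<close>. If \<open>l < 1\<close>, the second case forces both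
  coordinates at \<open>a\<close> to be positive, so that both points are on edges at \<open>a\<close> or equal to \<open>a\<close>.\<close>

lemma linked_same_edge_or_vertex:
  "linked V E p r l \<Longrightarrow>
    (\<exists>e\<in>E. p \<in> edge_points e \<and> r \<in> edge_points e \<and> edge_dist e p r \<le> l) \<or>
    (\<exists>a. (1 - p a) + (1 - r a) \<le> l)"
proof (induction rule: linked_edge_induct)
  case (refl p)
  then show ?case
  proof (cases rule: graph_pointsE)
    case (1 v)
    then have "(1 - p v) + (1 - p v) \<le> 0" by (simp add: vertex_point_apply)
    then show ?thesis by blast
  next
    case (2 e)
    then have "edge_dist e p p \<le> 0" by simp
    then show ?thesis using 2 by blast
  qed
next
  case (step e p q r l)
  from step.IH show ?case
  proof
    assume "\<exists>e\<in>E. q \<in> edge_points e \<and> r \<in> edge_points e \<and> edge_dist e q r \<le> l"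
    then obtain f where f: "f \<in> E" "q \<in> edge_points f" "r \<in> edge_points f" "edge_dist f q r \<le> l" by blast
    show ?thesis
    proof (cases "e = f")
      case True
      then have "edge_dist e p r \<le> edge_dist e p q + l"
        using f edge_dist_triangle[of e p r q] by simp
      then show ?thesis using True f step by blast
    next
      case False
      then obtain a where a: "q = vertex_point a" "a \<in> e" "a \<in> f"
        using edge_points_inter[of e f q] step f edge_card by blast
      have "edge_dist e p q = 1 - p a" "edge_dist f q r = 1 - r a"
        using edge_dist_vertex_point[of e a p] edge_dist_vertex_point[of f a r] a step f edge_card
        by (auto simp: edge_dist_commute)
      then have "(1 - p a) + (1 - r a) \<le> edge_dist e p q + l" using f(4) by simp
      then show ?thesis by blast
    qed
  next
    assume "\<exists>a. (1 - q a) + (1 - r a) \<le> l"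
    then obtain a where "(1 - q a) + (1 - r a) \<le> l" by blast
    moreover have "\<bar>p a - q a\<bar> \<le> edge_dist e p q"
      
    by (rule coordinate_le_edge_dist[OF edge_card[OF step.hyps(1)] step.hyps(2,3)])
    ultimately have "(1 - p a) + (1 - r a) \<le> edge_dist e p q + l"
      by linarith
    then show ?thesis by blast
  qed
qed

lemma walk_Cons: "{u, v} \<in> E \<Longrightarrow> walk V E vs \<Longrightarrow> hd vs = v \<Longrightarrow> walk V E (u # vs)"
  using edge_verts[of u v] by (cases vs) (auto simp: walk_def)

text \<open>The curve is read backwards, and the walk starts at a vertex \<open>a\<close> with positive coordinate. If
  the next point \<open>p\<close> has coordinate 0 at \<open>a\<close>, it is the other end of an edge at \<open>a\<close>, and this end is
  put in front of the walk.\<close>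

lemma linked_imp_walk:
  "linked V E p q l \<Longrightarrow> q = vertex_point v \<Longrightarrow>
    \<exists>vs. walk V E vs \<and> last vs = v \<and> p (hd vs) > 0 \<and> real (walk_length vs) + (1 - p (hd vs)) \<le> l"
proof (induction rule: linked_edge_induct)
  case (refl p)
  then have "v \<in> V" by simp
  then show ?case using refl by (intro exI[of _ "[v]"]) (auto simp: walk_def walk_length_def vertex_point_apply)
next
  case (step e p q r l)
  then obtain vs where vs: "walk V E vs" "last vs = v" "q (hd vs) > 0"
    "real (walk_length vs) + (1 - q (hd vs)) \<le> l" by blast
  define a where "a = hd vs"
  have ae: "a \<in> e" using edge_points_pos_mem[OF step.hyps(3) vs(3)] unfolding a_def .
  have c: "\<bar>p a - q a\<bar> \<le> edge_dist e p q" 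
    by (rule coordinate_le_edge_dist[OF edge_card[OF step.hyps(1)] step.hyps(2,3)])
  show ?case
  proof (cases "p a > 0")
    case True
    then show ?thesis using vs c by (intro exI[of _ vs]) (auto simp: a_def)
  next
    case False
    moreover have "0 \<le> p a" using step.hyps(2) by (simp add: edge_points_def)
    ultimately have pa: "p a = 0" by simp
    obtain b where b: "e = {a, b}" "a \<noteq> b"
      using card_2_other[OF edge_card[OF step.hyps(1)] ae] by (metis insert_commute)
    have "p = vertex_point b" using edge_points_eq_opposite_vertex[OF b(2)] b(1) step.hyps(2) pa by simp
    moreover have "walk V E (b # vs)"
    proof (rule walk_Cons[of b a])
      show "{b, a} \<in> E" using step.hyps(1) b(1) by (metis insert_commute)
      show "walk V E vs" "hd vs = a" using vs(1) by (simp_all add: a_def)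
    qed
    moreover have "real (walk_length (b # vs)) = real (walk_length vs) + 1"
      using vs(1) by (cases vs) (auto simp: walk_length_def walk_def)
    moreover have "p b = 1" using calculation(1) by (simp add: vertex_point_apply)
    ultimately show ?thesis using vs c pa
      by (intro exI[of _ "b # vs"]) (auto simp: a_def walk_def)
  qed
qed

lemma dist_imp_walk:
  assumes "u \<in> V" "v \<in> V" "d (vertex_point u) (vertex_point v) < c"
  obtains vs where "walk V E vs" "hd vs = u" "last vs = v" "real (walk_length vs) < c"
proof -
  obtain l where l: "linked V E (vertex_point u) (vertex_point v) l" "l < c"
    using dist_less_linked assms by (metis vertex_point_in_points)
  from linked_imp_walk[OF l(1) HOL.refl] obtain vs where vs: "walk V E vs" "last vs = v"
    "vertex_point u (hd vs) > 0" "real (walk_length vs) + (1 - vertex_point u (hd vs)) \<le> l" by blast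
  then have "hd vs = u" by (auto simp: vertex_point_apply split: if_splits)
  then show ?thesis using that vs l by (simp add: vertex_point_apply)
qed

end

section \<open>Zeros of continuous functions\<close>

lemma compact_zeros:
  fixes h :: "real \<Rightarrow> real"
  assumes "continuous_on {a..b} h"
  shows "compact {t \<in> {a..b}. h t = 0}"
proof -
  have "closed (h -` {0} \<inter> {a..b})"
    using assms continuous_on_closed_vimage[of "{a..b}" h] closed_real_atLeastAtMost by blast
  then have "compact ({a..b} \<inter> (h -` {0} \<inter> {a..b}))"
    by (rule compact_Int_closed[OF compact_Icc])
  moreover have "{a..b} \<inter> (h -` {0} \<inter> {a..b}) = {t \<in> {a..b}. h t = 0}" by auto
  ultimately show ?thesis by simp
qed

lemma first_zero:
  fixes h :: "real \<Rightarrow> real"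
  assumes "continuous_on {a..b} h" "a \<le> b" "h b = 0"
  obtains s where "a \<le> s" "s \<le> b" "h s = 0" "\<And>t. a \<le> t \<Longrightarrow> t < s \<Longrightarrow> h t \<noteq> 0"
proof -
  have "b \<in> {t \<in> {a..b}. h t = 0}" using assms by simp
  then obtain s where "s \<in> {t \<in> {a..b}. h t = 0}" "\<forall>t\<in>{t \<in> {a..b}. h t = 0}. s \<le> t"
    using compact_attains_inf[OF compact_zeros[OF assms(1)]] by blast
  then show ?thesis using that[of s] by force
qed

lemma last_zero:
  fixes h :: "real \<Rightarrow> real"
  assumes "continuous_on {a..b} h" "a \<le> b" "h a = 0"
  obtains s where "a \<le> s" "s \<le> b" "h s = 0" "\<And>t. s < t \<Longrightarrow> t \<le> b \<Longrightarrow> h t \<noteq> 0"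
proof -
  have "a \<in> {t \<in> {a..b}. h t = 0}" using assms by simp
  then obtain s where "s \<in> {t \<in> {a..b}. h t = 0}" "\<forall>t\<in>{t \<in> {a..b}. h t = 0}. t \<le> s"
    using compact_attains_sup[OF compact_zeros[OF assms(1)]] by blast
  then show ?thesis using that[of s] assms(2) by (smt (verit) atLeastAtMost_iff mem_Collect_eq)
qed

lemma lipschitz_imp_continuous_on:
  fixes h :: "real \<Rightarrow> real"
  assumes "\<And>s t. s \<in> A \<Longrightarrow> t \<in> A \<Longrightarrow> \<bar>h s - h t\<bar> \<le> c * \<bar>s - t\<bar>" "c > 0"
  shows "continuous_on A h"
  unfolding continuous_on_def
proof (intro ballI tendstoI)
  fix x e :: real assume x: "x \<in> A" and e: "0 < e"
  show "eventually (\<lambda>y. dist (h y) (h x) < e) (at x within A)"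
    unfolding eventually_at dist_real_def
  proof (intro exI[of _ "e / c"] conjI ballI impI)
    fix y assume y: "y \<in> A" "y \<noteq> x \<and> \<bar>y - x\<bar> < e / c"
    have "\<bar>h y - h x\<bar> \<le> c * \<bar>y - x\<bar>" using assms(1) y(1) x .
    also have "\<dots> < e" using y(2) assms(2) by (simp add: field_simps)
    finally show "\<bar>h y - h x\<bar> < e" .
  qed (use e assms(2) in simp)
qed

section \<open>Walks and their edges\<close>

lemma walk_edges_Nil [simp]: "walk_edges [] = {}"
  and walk_edges_single [simp]: "walk_edges [x] = {}"
  by (simp_all add: walk_edges_def)

lemma walk_edges_Cons2 [simp]: "walk_edges (x # y # zs) = insert {x, y} (walk_edges (y # zs))"
proof (intro set_eqI iffI)
  fix e assume "e \<in> walk_edges (x # y # zs)"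
  then obtain i where i: "Suc i < length (x # y # zs)" "e = {(x # y # zs) ! i, (x # y # zs) ! Suc i}"
    unfolding walk_edges_def by blast
  then show "e \<in> insert {x, y} (walk_edges (y # zs))"
    unfolding walk_edges_def by (cases i) auto
next
  fix e assume "e \<in> insert {x, y} (walk_edges (y # zs))"
  then consider "e = {x, y}"
    | i where "Suc i < length (y # zs)" "e = {(y # zs) ! i, (y # zs) ! Suc i}"
    unfolding walk_edges_def by blast
  then show "e \<in> walk_edges (x # y # zs)"
  proof cases
    case 1
    then show ?thesis unfolding walk_edges_def by (auto intro!: exI[of _ 0])
  next
    case 2
    then show ?thesis unfolding walk_edges_def by (auto intro!: exI[of _ "Suc i"])
  qed
qed

lemma walk_edges_join: "walk_edges (xs @ a # ys) = walk_edges (xs @ [a]) \<union> walk_edges (a # ys)"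
  by (induction xs rule: induct_list012) auto

lemma walk_edges_append:
  assumes "xs \<noteq> []"
  shows "walk_edges (xs @ ys) = walk_edges xs \<union> walk_edges (last xs # ys)"
proof -
  have eqs: "butlast xs @ last xs # ys = xs @ ys" "butlast xs @ [last xs] = xs"
    using append_butlast_last_id[OF assms] by (metis append.assoc append_Cons append_Nil, simp)
  show ?thesis using walk_edges_join[of "butlast xs" "last xs" ys] unfolding eqs .
qed

lemma walk_edges_append_subset: "walk_edges xs \<union> walk_edges ys \<subseteq> walk_edges (xs @ ys)"
proof (induction xs rule: induct_list012)
  case (2 x)
  then show ?case by (cases ys) auto
qed auto

lemma walk_edges_rev [simp]: "walk_edges (rev xs) = walk_edges xs"
proof (induction xs rule: induct_list012)
  case (3 x y zs)
  have "walk_edges (rev (x # y # zs)) = walk_edges (rev zs @ [y]) \<union> walk_edges [y, x]"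
    using walk_edges_join[of "rev zs" y "[x]"] by simp
  then show ?case using "3.IH"(2) by (auto simp: insert_commute)
qed auto

lemma walk_edges_subset_set: "e \<in> walk_edges vs \<Longrightarrow> e \<subseteq> set vs"
  by (auto simp: walk_edges_def)

lemma walk_iff_edges: "walk V E vs \<longleftrightarrow> vs \<noteq> [] \<and> set vs \<subseteq> V \<and> walk_edges vs \<subseteq> E"
  unfolding walk_def by (induction vs rule: induct_list012) auto

lemma walk_rev: "walk V E (rev vs) \<longleftrightarrow> walk V E vs"
  by (simp add: walk_iff_edges)

lemma distinct_list_path:
  assumes "distinct ds" "u \<in> set ds" "v \<in> set ds"
  shows "\<exists>vs. vertex_path (set ds) (walk_edges ds) vs \<and> hd vs = u \<and> last vs = v"
proof -
  have later: "\<exists>vs. vertex_path (set ds) (walk_edges ds) vs \<and> hd vs = a \<and> last vs = b"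
    if ab: "ds = xs @ a # ys" "b \<in> set ys" for a b xs ys
  proof -
    obtain ys1 ys2 where ys: "ys = ys1 @ b # ys2" using ab(2) split_list by metis
    have "walk_edges ds = walk_edges (xs @ [a]) \<union> walk_edges ((a # ys1) @ b # ys2)"
      using walk_edges_join[of xs a ys] ab(1) ys by simp
    also have "walk_edges ((a # ys1) @ b # ys2) = walk_edges ((a # ys1) @ [b]) \<union> walk_edges (b # ys2)"
      by (rule walk_edges_join)
    finally have "walk_edges (a # ys1 @ [b]) \<subseteq> walk_edges ds" by auto
    then show ?thesis using assms(1) ab(1) ys
      by (intro exI[of _ "a # ys1 @ [b]"]) (auto simp: vertex_path_def walk_iff_edges)
  qed
  obtain xs ys where ds: "ds = xs @ u # ys" using assms(2) split_list by metis
  consider "v = u" | "v \<in> set ys" | "v \<in> set xs" using ds assms(3) by auto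
  then show ?thesis
  proof cases
    case 1
    then show ?thesis using assms(2)
      by (intro exI[of _ "[u]"]) (auto simp: vertex_path_def walk_iff_edges)
  next
    case 2
    then show ?thesis using later ds by blast
  next
    case 3
    then obtain xs1 xs2 where "ds = xs1 @ v # (xs2 @ u # ys)" using ds split_list[of v xs] by auto
    then obtain vs where "vertex_path (set ds) (walk_edges ds) vs" "hd vs = v" "last vs = u"
      using later[of xs1 v "xs2 @ u # ys" u] by auto
    then show ?thesis
      by (intro exI[of _ "rev vs"])
        (simp add: vertex_path_def walk_rev hd_rev last_rev)
  qed
qed

section \<open>Cycles as metric graphs\<close>

text \<open>The vertices and edges of a cycle form a connected graph of their own, whose length metric
  is by definition the metric of the cycle. So everything proved about the metric of a connected
  graph holds for \<open>cycle_dist C\<close>, under the prefix \<open>cyc\<close>.\<close>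

locale graph_cycle = connected_graph +
  fixes C :: "'a list"
  assumes cycle: "vertex_cycle V E C"
begin

lemma cycle_set: "set C \<subseteq> V" and cycle_edges: "walk_edges C \<subseteq> E"
  and cycle_nonempty: "C \<noteq> []" and cycle_length: "4 \<le> length C"
  and cycle_closed: "hd C = last C" and cycle_distinct: "distinct (tl C)"
  using cycle by (auto simp: vertex_cycle_def walk_iff_edges)

lemma cycle_Cons: "C = hd C # tl C" and cycle_tl_nonempty: "tl C \<noteq> []"
  using cycle_nonempty cycle_length by (cases C; cases "tl C"; simp)+

lemma set_tl_cycle: "set (tl C) = set C"
proof -
  have "last C = last (tl C)" using cycle_Cons cycle_tl_nonempty by (metis last_tl)
  then have "hd C \<in> set (tl C)" using cycle_closed cycle_tl_nonempty by simp
  then show ?thesis using cycle_Cons by (metis insert_absorb list.simps(15))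
qed

lemma walk_edges_tl_cycle: "walk_edges (tl C) \<subseteq> walk_edges C"
  using cycle_Cons cycle_tl_nonempty by (metis list.exhaust subset_insertI walk_edges_Cons2)

sublocale cyc: connected_graph "set C" "walk_edges C"
proof
  show "e \<subseteq> set C \<and> card e = 2" if "e \<in> walk_edges C" for e
    using that walk_edges_subset_set edges cycle_edges by blast
  fix u v assume "u \<in> set C" "v \<in> set C"
  then obtain vs where "vertex_path (set (tl C)) (walk_edges (tl C)) vs" "hd vs = u" "last vs = v"
    using distinct_list_path[OF cycle_distinct] set_tl_cycle by metis
  then show "\<exists>vs. vertex_path (set C) (walk_edges C) vs \<and> hd vs = u \<and> last vs = v"
    using set_tl_cycle walk_edges_tl_cycle
    by (intro exI[of _ vs]) (auto simp: vertex_path_def walk_iff_edges)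
qed

lemma trace_subset: "trace C \<subseteq> X"
  using cycle_set cycle_edges by (auto simp: trace_def graph_points_def)

lemma linked_cycle_imp_linked:
  assumes "linked (set C) (walk_edges C) p q l"
  shows "linked V E p q l"
  using assms
proof (induction rule: linked.induct)
  case (refl p)
  then show ?case using trace_subset by (auto simp: trace_def intro: linked.refl)
next
  case (step e p q r l)
  then show ?case using cycle_edges by (auto intro: linked.step)
qed

lemma dist_le_cycle_dist:
  assumes "p \<in> trace C" "q \<in> trace C"
  shows "d p q \<le> cycle_dist C p q"
  unfolding cycle_dist_def using assms linked_cycle_imp_linked dist_le_linked
  by (intro cyc.dist_ge) (auto simp: trace_def)

lemma vertex_point_in_trace: "vertex_point a \<in> trace C \<longleftrightarrow> a \<in> set C"
  unfolding trace_def by simp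

text \<open>Different edges meet only in vertices.\<close>

lemma trace_edge:
  assumes "p \<in> trace C" "e \<in> E" "p \<in> edge_points e" "\<And>a. p \<noteq> vertex_point a"
  shows "e \<in> walk_edges C"
  using assms(1) unfolding trace_def
proof (cases rule: cyc.graph_pointsE)
  case (2 f)
  then show ?thesis using edge_points_inter[of e f p] assms edge_card cycle_edges by blast
qed (use assms(4) in blast)

text \<open>Two points at distance less than 1 are on one edge, or on two edges with a common vertex. If
  the points belong to the cycle, so does the part of these edges between them.\<close>

lemma linked_cycle_local:
  assumes "linked V E p q l" "l < 1" "p \<in> trace C" "q \<in> trace C"
  shows "cycle_dist C p q \<le> l"
proof -
  from linked_same_edge_or_vertex[OF assms(1)] show ?thesis
  proof
    assume "\<exists>e\<in>E. p \<in> edge_points e \<and> q \<in> edge_points e \<and> edge_dist e p q \<le> l"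
    then obtain e where e: "e \<in> E" "p \<in> edge_points e" "q \<in> edge_points e" "edge_dist e p q \<le> l"
      by blast
    consider "e \<in> walk_edges C" | a b where "p = vertex_point a" "q = vertex_point b"
      using trace_edge e assms(3,4) by metis
    then show ?thesis
    proof cases
      case 1
      then show ?thesis
        using cyc.dist_edge_points[OF 1 e(2,3)] e(4) by (simp add: cycle_dist_def)
    next
      case 2
      have "a = b" using linked_coordinate[OF assms(1), of a] assms(2) 2
        by (auto simp: vertex_point_apply split: if_splits)
      then show ?thesis using 2 assms linked_points[OF assms(1)]
        by (simp add: cycle_dist_def trace_def)
    qed
  next
    assume "\<exists>a. (1 - p a) + (1 - q a) \<le> l"
    then obtain a where a: "(1 - p a) + (1 - q a) \<le> l" by blast
    have p: "p \<in> cyc.X" and q: "q \<in> cyc.X" using assms by (auto simp: trace_def)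
    have "p a \<le> 1" "q a \<le> 1" using cyc.graph_points_coordinate p q by auto
    then have "p a > 0" "q a > 0" using a assms(2) by auto
    then have "linked (set C) (walk_edges C) p q ((1 - p a) + (1 - q a))"
      using cyc.linked_trans[OF cyc.linked_to_support(1)[OF p]
          cyc.linked_sym[OF cyc.linked_to_support(1)[OF q]]] by blast
    then show ?thesis using cyc.dist_le_linked[of p q] a by (fastforce simp: cycle_dist_def)
  qed
qed

lemma cycle_dist_le_dist:
  assumes "p \<in> trace C" "q \<in> trace C" "d p q < 1"
  shows "cycle_dist C p q \<le> d p q"
proof (rule dense_ge_bounded[OF assms(3)])
  fix c assume c: "d p q < c" "c < 1"
  then obtain l where "linked V E p q l" "l < c"
    using dist_less_linked[of p q c] assms trace_subset by blast
  then show "cycle_dist C p q \<le> c" using linked_cycle_local[of p q l] assms c by simp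
qed

end

section \<open>Geodesics\<close>

text \<open>A geodesic together with its parametrization, which \<open>geodesic\<close> only asserts to exist.\<close>

definition isometric_path :: "'p set \<Rightarrow> ('p \<Rightarrow> 'p \<Rightarrow> real) \<Rightarrow> (real \<Rightarrow> 'p) \<Rightarrow> real \<Rightarrow> bool" where
  "isometric_path X d \<gamma> L \<longleftrightarrow> 0 \<le> L \<and> \<gamma> ` {0..L} \<subseteq> X \<and>
    (\<forall>s\<in>{0..L}. \<forall>t\<in>{0..L}. d (\<gamma> s) (\<gamma> t) = \<bar>s - t\<bar>)"

lemma isometric_path_dist:
  "isometric_path X d \<gamma> L \<Longrightarrow> 0 \<le> s \<Longrightarrow> s \<le> L \<Longrightarrow> 0 \<le> t \<Longrightarrow> t \<le> L \<Longrightarrow> d (\<gamma> s) (\<gamma> t) = \<bar>s - t\<bar>"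
  by (simp add: isometric_path_def)

lemma isometric_path_mem:
  "isometric_path X d \<gamma> L \<Longrightarrow> 0 \<le> s \<Longrightarrow> s \<le> L \<Longrightarrow> \<gamma> s \<in> X"
  by (auto simp: isometric_path_def)

lemma isometric_path_shift:
  assumes "isometric_path X d \<gamma> L" "0 \<le> a" "a \<le> b" "b \<le> L"
  shows "isometric_path X d (\<lambda>s. \<gamma> (a + s)) (b - a)"
  using assms by (auto simp: isometric_path_def)

lemma isometric_path_reverse:
  assumes "isometric_path X d \<gamma> L"
  shows "isometric_path X d (\<lambda>s. \<gamma> (L - s)) L"
  using assms by (auto simp: isometric_path_def)

context graph_cycle
begin

text \<open>The two metrics agree at small distances, and a geodesic is composed of short pieces.\<close>

lemma cycle_dist_isometric_path:
  assumes g: "isometric_path X d \<gamma> L" and C: "\<gamma> ` {0..L} \<subseteq> trace C"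
    and st: "0 \<le> s" "s \<le> L" "0 \<le> t" "t \<le> L"
  shows "cycle_dist C (\<gamma> s) (\<gamma> t) \<le> \<bar>s - t\<bar>"
proof -
  have steps: "cycle_dist C (\<gamma> s) (\<gamma> t) \<le> t - s"
    if "t - s \<le> real n / 2" "0 \<le> s" "s \<le> t" "t \<le> L" for n s t
    using that
  proof (induction n arbitrary: s)
    case 0
    then have "s = t" by simp
    moreover have "\<gamma> s \<in> cyc.X" using C 0 by (force simp: trace_def)
    ultimately show ?case by (simp add: cycle_dist_def)
  next
    case (Suc n)
    show ?case
    proof (cases "t - s < 1")
      case True
      then show ?thesis
        using cycle_dist_le_dist[of "\<gamma> s" "\<gamma> t"] isometric_path_dist[OF g, of s t] C Suc.prems
        by (simp add: image_subset_iff)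
    next
      case False
      define r where "r = s + 1 / 2"
      have mem: "\<gamma> s \<in> trace C" "\<gamma> t \<in> trace C" "\<gamma> r \<in> trace C"
        using C Suc.prems False by (auto simp: r_def image_subset_iff)
      have "cycle_dist C (\<gamma> r) (\<gamma> t) \<le> t - r"
        using Suc.prems False by (intro Suc.IH) (auto simp: r_def field_simps)
      moreover have "cycle_dist C (\<gamma> s) (\<gamma> r) \<le> r - s"
        using cycle_dist_le_dist[of "\<gamma> s" "\<gamma> r"] isometric_path_dist[OF g, of s r] mem Suc.prems False
        by (simp add: r_def)
      moreover have "cycle_dist C (\<gamma> s) (\<gamma> t) \<le> cycle_dist C (\<gamma> s) (\<gamma> r) + cycle_dist C (\<gamma> r) (\<gamma> t)"
        using cyc.dist_triangle mem by (simp add: cycle_dist_def trace_def)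
      ultimately show ?thesis by linarith
    qed
  qed
  obtain n where n: "\<bar>s - t\<bar> \<le> real n / 2"
    using real_arch_simple[of "2 * \<bar>s - t\<bar>"] by (metis le_divide_eq_numeral1(1) mult.commute)
  show ?thesis
  proof (cases "s \<le> t")
    case True
    then show ?thesis using steps[of t s n] n st by simp
  next
    case False
    then show ?thesis using steps[of s t n] n st cyc.dist_commute[of "\<gamma> s" "\<gamma> t"]
      by (simp add: cycle_dist_def)
  qed
qed

end

section \<open>Removing a point from a cycle\<close>

text \<open>The trace and the metric of a cycle depend only on its sets of vertices and edges, so that a
  cycle may be assumed to start at any of its vertices.\<close>

lemma vertex_cycle_rotate:
  assumes "vertex_cycle V E C" "a \<in> set C"
  obtains C' where "vertex_cycle V E C'" "hd C' = a" "set C' = set C" "walk_edges C' = walk_edges C"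
proof -
  obtain xs ys where C: "C = xs @ a # ys" using assms(2) split_list by metis
  show ?thesis
  proof (cases xs)
    case Nil
    then show ?thesis using that[of C] assms C by simp
  next
    case (Cons h xs')
    have cyc: "walk V E C" "4 \<le> length C" "h = last (a # ys)" "distinct (xs' @ a # ys)"
      using assms(1) C Cons by (auto simp: vertex_cycle_def split: if_splits)
    define zs where "zs = butlast (a # ys)"
    have ays: "a # ys = zs @ [h]" using cyc(3) by (simp add: zs_def)
    let ?C = "a # ys @ xs' @ [a]"
    have e: "walk_edges ?C = walk_edges C"
    proof -
      have "walk_edges ?C = walk_edges (zs @ h # xs' @ [a])" using ays by (metis append_Cons append_assoc append_Nil)
      also have "\<dots> = walk_edges (zs @ [h]) \<union> walk_edges ((h # xs') @ a # [])"
        using walk_edges_join[of zs h "xs' @ [a]"] by simp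
      also have "\<dots> = walk_edges ((h # xs') @ [a]) \<union> walk_edges (a # ys)" using ays by auto
      also have "\<dots> = walk_edges C" using walk_edges_join[of "h # xs'" a ys] C Cons by simp
      finally show ?thesis .
    qed
    have "h \<in> set (a # ys)" using ays by simp
    then have s: "set ?C = set C" using C Cons by auto
    have "vertex_cycle V E ?C"
      using cyc e s C Cons by (auto simp: vertex_cycle_def walk_iff_edges)
    then show ?thesis using that[of ?C] e s by simp
  qed
qed

text \<open>Cutting a cycle open at an edge leaves a path from one end of this edge to the other, and the
  edge does not occur in it a second time.\<close>

lemma hd_last_not_edge:
  assumes "distinct ws" "3 \<le> length ws"
  shows "{hd ws, last ws} \<notin> walk_edges ws"
proof -
  obtain b c w ws' where ws: "ws = b # c # w # ws'"
    using assms(2) by (metis One_nat_def Suc_le_length_iff numeral_3_eq_3)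
  have "last (w # ws') \<in> set (w # ws')" by (rule last_in_set) simp
  then have "last ws \<noteq> c" "last ws \<noteq> b" using ws assms(1) by auto
  moreover have "b \<notin> e" if "e \<in> walk_edges (c # w # ws')" for e
    using walk_edges_subset_set[OF that] ws assms(1) by auto
  ultimately show ?thesis using ws by (auto simp: doubleton_eq_iff)
qed

context graph_cycle
begin

text \<open>By the intermediate value theorem, \<open>f\<close> can pass from one side of the level \<open>c\<close> to the other
  only at a point with value \<open>c\<close>, that is, at \<open>z\<close>.\<close>

lemma same_side_on_edge:
  fixes f :: "('a \<Rightarrow> real) \<Rightarrow> real"
  assumes lip: "\<And>p q. p \<in> X \<Longrightarrow> q \<in> X \<Longrightarrow> \<bar>f p - f q\<bar> \<le> d p q"
    and lev: "\<And>p. p \<in> trace C \<Longrightarrow> f p = c \<Longrightarrow> p = z"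
    and e: "{u, v} \<in> walk_edges C" and st: "0 \<le> s" "s \<le> t" "t \<le> 1"
    and z: "\<And>r. s \<le> r \<Longrightarrow> r \<le> t \<Longrightarrow> on_edge u v r \<noteq> z"
  shows "f (on_edge u v s) < c \<longleftrightarrow> f (on_edge u v t) < c"
proof -
  have eE: "{u, v} \<in> E" using e cycle_edges by auto
  have cont: "continuous_on {s..t} (\<lambda>r. f (on_edge u v r))"
  proof (rule lipschitz_imp_continuous_on[of _ _ 1])
    fix r r' assume "r \<in> {s..t}" "r' \<in> {s..t}"
    then show "\<bar>f (on_edge u v r) - f (on_edge u v r')\<bar> \<le> 1 * \<bar>r - r'\<bar>"
      using lip[OF on_edge_in_points[OF eE] on_edge_in_points[OF eE], of r r']
        dist_on_edge[OF eE, of r r'] st by simp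
  qed simp
  have ne: "f (on_edge u v r) \<noteq> c" if "s \<le> r" "r \<le> t" for r
    using lev[of "on_edge u v r"] z[OF that] cyc.on_edge_in_points[OF e, of r] that st
    by (auto simp: trace_def)
  show ?thesis
  proof (rule ccontr)
    assume "\<not> ?thesis"
    then consider "f (on_edge u v s) \<le> c" "c \<le> f (on_edge u v t)"
      | "f (on_edge u v t) \<le> c" "c \<le> f (on_edge u v s)" by linarith
    then show False
      using IVT'[OF _ _ st(2) cont, of c] IVT2'[OF _ _ st(2) cont, of c] ne by cases blast+
  qed
qed

text \<open>This expresses that the cycle minus \<open>z\<close> is connected. Each of its points can be moved along an
  edge to a vertex without meeting \<open>z\<close>, and the vertices other than \<open>z\<close> are on a path that avoids
  \<open>z\<close>: the cycle without the vertex \<open>z\<close>, or without the edge of which \<open>z\<close> is an inner point.\<close>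

lemma cycle_minus_point_connected:
  fixes f :: "('a \<Rightarrow> real) \<Rightarrow> real"
  assumes lip: "\<And>p q. p \<in> X \<Longrightarrow> q \<in> X \<Longrightarrow> \<bar>f p - f q\<bar> \<le> d p q"
    and lev: "\<And>p. p \<in> trace C \<Longrightarrow> f p = c \<Longrightarrow> p = z"
    and z: "z \<in> trace C"
    and p: "p \<in> trace C" "p \<noteq> z" and q: "q \<in> trace C" "q \<noteq> z"
  shows "f p < c \<longleftrightarrow> f q < c"
proof -
  have edge_side: "f (on_edge u v s) < c \<longleftrightarrow> f (on_edge u v t) < c"
    if "{u, v} \<in> walk_edges C" "0 \<le> s" "s \<le> t" "t \<le> 1"
      "\<And>r. s \<le> r \<Longrightarrow> r \<le> t \<Longrightarrow> on_edge u v r \<noteq> z" for u v s t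
    by (rule same_side_on_edge[where z = z]) (fact lip lev that)+
  have to_vertex: "\<exists>a\<in>set C. vertex_point a \<noteq> z \<and> (f p < c \<longleftrightarrow> f (vertex_point a) < c)"
    if p: "p \<in> trace C" "p \<noteq> z" for p
    using p(1) unfolding trace_def
  proof (cases rule: cyc.graph_pointsE)
    case (1 v)
    then show ?thesis using p by blast
  next
    case (2 e)
    then obtain u v where uv: "e = {u, v}" "u \<noteq> v" "u \<in> set C" "v \<in> set C" using cyc.edgeE by metis
    have p': "p \<in> edge_points {u, v}" using 2 uv by simp
    define s where "s = p v"
    have s: "p = on_edge u v s" "0 \<le> s" "s \<le> 1"
      using edge_points_eq_on_edge(1-3)[OF uv(2) p'] by (simp_all add: s_def)
    have e: "{u, v} \<in> walk_edges C" using 2 uv by simp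
    show ?thesis
    proof (cases "\<exists>r. s \<le> r \<and> r \<le> 1 \<and> on_edge u v r = z")
      case False
      then have "f p < c \<longleftrightarrow> f (on_edge u v 1) < c" "on_edge u v 1 \<noteq> z"
        using edge_side[OF e s(2,3)] s by auto
      then show ?thesis using uv(4) by auto
    next
      case True
      then obtain r where r: "s \<le> r" "on_edge u v r = z" by blast
      have nz: "on_edge u v r' \<noteq> z" if "r' \<le> s" for r'
      proof
        assume "on_edge u v r' = z"
        then have "r' = r" using r(2) on_edge_right[OF uv(2)] by metis
        then show False using that r s(1) p(2) by simp
      qed
      then have "f (on_edge u v 0) < c \<longleftrightarrow> f p < c"
        using edge_side[OF e order.refl s(2,3)] s(1) by simp
      then show ?thesis using uv(3) nz[OF s(2)] by auto
    qed
  qed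
  have along: "f (vertex_point u) < c \<longleftrightarrow> f (vertex_point v) < c"
    if "walk_edges ws \<subseteq> walk_edges C" "\<And>e. e \<in> walk_edges ws \<Longrightarrow> z \<notin> edge_points e"
      "u \<in> set ws" "v \<in> set ws" for ws u v
    using that
  proof (induction ws arbitrary: u v rule: induct_list012)
    case (3 x y zs)
    have xy: "{x, y} \<in> walk_edges C" "z \<notin> edge_points {x, y}" using "3.prems"(1,2) by auto
    have "f (on_edge x y 0) < c \<longleftrightarrow> f (on_edge x y 1) < c"
    proof (rule edge_side[OF xy(1)])
      show "on_edge x y r \<noteq> z" if "0 \<le> r" "r \<le> 1" for r
        using on_edge_mem[OF cyc.edge_neq[OF xy(1)] that] xy(2) by auto
    qed auto
    then have "f (vertex_point w) < c \<longleftrightarrow> f (vertex_point y) < c" if "w \<in> set (x # y # zs)" for w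
      using "3.IH"(2)[of w y] "3.prems"(1,2) that by auto
    then show ?case using "3.prems"(3,4) by blast
  qed auto
  obtain ws where ws: "walk_edges ws \<subseteq> walk_edges C" "\<And>e. e \<in> walk_edges ws \<Longrightarrow> z \<notin> edge_points e"
    "\<And>a. a \<in> set C \<Longrightarrow> vertex_point a \<noteq> z \<Longrightarrow> a \<in> set ws"
  proof (cases "\<exists>a\<in>set C. z = vertex_point a")
    case True
    \<comment> \<open>Let the cycle start and end at \<open>z\<close>, and drop both occurrences.\<close>
    then obtain a where a: "a \<in> set C" "z = vertex_point a" by blast
    obtain C' where C': "vertex_cycle V E C'" "hd C' = a" "set C' = set C" "walk_edges C' = walk_edges C"
      using vertex_cycle_rotate[OF cycle a(1)] .
    interpret C': graph_cycle V E C' by unfold_locales (rule C')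
    define ms where "ms = butlast (tl C')"
    have "last (tl C') = a"
      using C'.cycle_closed C'.cycle_tl_nonempty C'(2) by (simp add: last_tl)
    then have tl: "tl C' = ms @ [a]" using C'.cycle_tl_nonempty by (metis ms_def append_butlast_last_id)
    then have d: "a \<notin> set ms" using C'.cycle_distinct by simp
    have "walk_edges ms \<subseteq> walk_edges (tl C')" using tl walk_edges_append_subset[of ms "[a]"] by simp
    then have 1: "walk_edges ms \<subseteq> walk_edges C" using C'.walk_edges_tl_cycle C'(4) by simp
    have "z \<notin> edge_points e" if "e \<in> walk_edges ms" for e
      using edge_points_pos_mem[of z e a] walk_edges_subset_set[OF that] d a(2)
      by (auto simp: vertex_point_apply)
    moreover have "b \<in> set ms" if "b \<in> set C" "vertex_point b \<noteq> z" for b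
      using that C'(3) C'.set_tl_cycle tl a(2) by auto
    ultimately show ?thesis using that[of ms] 1 by blast
  next
    case False
    with z obtain e where e: "e \<in> walk_edges C" "z \<in> edge_points e"
      unfolding trace_def by (metis cyc.graph_pointsE)
    \<comment> \<open>The path runs from \<open>b\<close> to the end of the list and on from its start to \<open>a\<close>.\<close>
    obtain xs a b ys where C: "C = xs @ a # b # ys" "e = {a, b}"
    proof -
      obtain i where i: "Suc i < length C" "e = {C ! i, C ! Suc i}" using e(1) by (auto simp: walk_edges_def)
      then have "C = take i C @ C ! i # C ! Suc i # drop (Suc (Suc i)) C"
        by (metis Cons_nth_drop_Suc Suc_lessD append_take_drop_id)
      then show ?thesis using that i by blast
    qed
    have split: "\<exists>ws. distinct ws \<and> hd ws = b \<and> last ws = a \<and> 3 \<le> length ws \<and>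
        set ws = set C \<and> walk_edges ws \<subseteq> walk_edges C"
    proof (cases xs)
      case Nil
      then have "C = a # b # ys" using C by simp
      moreover have "length C \<ge> 4" "last C = a" using cycle_length cycle_closed C Nil by auto
      ultimately show ?thesis using cycle_distinct set_tl_cycle
        by (intro exI[of _ "b # ys"]) auto
    next
      \<comment> \<open>The first vertex \<open>h\<close> of the list is also its last, hence only the tail of \<open>xs\<close> is appended.\<close>
      case (Cons h xs')
      have h: "last (b # ys) = h" using cycle_closed C Cons by simp
      define zs where "zs = butlast (b # ys)"
      have bys: "b # ys = zs @ [h]" unfolding zs_def using h by (metis append_butlast_last_id list.distinct(1))
      let ?ws = "b # ys @ xs' @ [a]"
      have "walk_edges ?ws = walk_edges (zs @ h # xs' @ [a])" using bys
        by (metis append_Cons append_assoc append_Nil)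
      also have "\<dots> = walk_edges (b # ys) \<union> walk_edges (h # xs' @ [a])"
        using walk_edges_join[of zs h "xs' @ [a]"] bys by simp
      also have "\<dots> \<subseteq> walk_edges C"
        using walk_edges_join[of "h # xs'" a "b # ys"] C Cons by auto
      finally have "walk_edges ?ws \<subseteq> walk_edges C" .
      moreover have "set ?ws = set C" using set_tl_cycle C Cons by auto
      moreover have "distinct ?ws" using cycle_distinct C Cons by auto
      moreover have "3 \<le> length ?ws" using cycle_length C Cons by simp
      ultimately show ?thesis by (intro exI[of _ ?ws]) auto
    qed
    then obtain ws where ws: "distinct ws" "hd ws = b" "last ws = a" "3 \<le> length ws"
        "set ws = set C" "walk_edges ws \<subseteq> walk_edges C" by blast
    have "z \<notin> edge_points g" if g: "g \<in> walk_edges ws" for g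
    proof
      assume "z \<in> edge_points g"
      then have "g = e"
        using edge_points_inter[of g e z] e g ws(6) cyc.edge_card False
        by (metis cyc.edges subset_iff)
      then show False using hd_last_not_edge[OF ws(1,4)] ws(2,3) g C(2) by (simp add: insert_commute)
    qed
    then show ?thesis using that[of ws] ws(5,6) by blast
  qed
  from to_vertex[OF p] to_vertex[OF q] show ?thesis using along[OF ws(1,2)] ws(3) by metis
qed

end

section \<open>Bigons\<close>

locale bigon_cycle = graph_cycle +
  fixes \<alpha> \<beta> :: "real \<Rightarrow> 'a \<Rightarrow> real" and L :: real
  assumes \<alpha>: "isometric_path (graph_points V E) (graph_dist V E) \<alpha> L"
    and \<beta>: "isometric_path (graph_points V E) (graph_dist V E) \<beta> L"
    and start_eq: "\<alpha> 0 = \<beta> 0" and end_eq: "\<alpha> L = \<beta> L"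
    and trace_eq: "trace C = \<alpha> ` {0..L} \<union> \<beta> ` {0..L}"
begin

lemma swap: "bigon_cycle V E C \<beta> \<alpha> L"
  using \<alpha> \<beta> start_eq end_eq trace_eq by unfold_locales auto

lemma length_nonneg: "0 \<le> L"
  using \<alpha> by (simp add: isometric_path_def)

lemma start_in: "\<alpha> 0 \<in> X" and end_in: "\<alpha> L \<in> X"
  using isometric_path_mem[OF \<alpha>] length_nonneg by auto

lemma side_subset: "\<alpha> ` {0..L} \<subseteq> X" "\<beta> ` {0..L} \<subseteq> X"
  using \<alpha> \<beta> by (auto simp: isometric_path_def)

lemma dist_start:
  assumes "0 \<le> s" "s \<le> L"
  shows "d (\<alpha> 0) (\<alpha> s) = s" "d (\<alpha> 0) (\<beta> s) = s" "d (\<alpha> s) (\<alpha> L) = L - s" "d (\<beta> s) (\<alpha> L) = L - s"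
  using isometric_path_dist[OF \<alpha>, of 0 s] isometric_path_dist[OF \<beta>, of 0 s]
    isometric_path_dist[OF \<alpha>, of s L] isometric_path_dist[OF \<beta>, of s L] assms start_eq end_eq
  by simp_all

lemma dist_diff: 
  assumes "p \<in> X" "q \<in> X" "r \<in> X"
  shows "\<bar>d r p - d r q\<bar> \<le> d p q"
  using dist_triangle[of r p q] dist_triangle[of r q p] dist_commute[of p q] assms by linarith

text \<open>Measure levels by the distance from \<open>\<alpha> 0\<close>. Each side has one point on each level, so a
  common point of intermediate level would be the only point of the cycle on its level and would
  separate the points below from those above.\<close>

lemma sides_inter:
  assumes "p \<in> \<alpha> ` {0..L}" "p \<in> \<beta> ` {0..L}"
  shows "p = \<alpha> 0 \<or> p = \<alpha> L"
proof (rule ccontr)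
  assume neg: "\<not> ?thesis"
  obtain s where s: "p = \<alpha> s" "0 \<le> s" "s \<le> L" using assms(1) by auto
  have level: "q = \<alpha> s \<or> q = \<beta> s" if q: "q \<in> trace C" "d (\<alpha> 0) q = s" for q
  proof -
    obtain t where t: "0 \<le> t" "t \<le> L" "q = \<alpha> t \<or> q = \<beta> t" using q(1) trace_eq by auto
    then have "t = s" using dist_start[OF t(1,2)] q(2) by auto
    then show ?thesis using t(3) by blast
  qed
  obtain t where t: "p = \<beta> t" "0 \<le> t" "t \<le> L" using assms(2) by auto
  then have "t = s" using dist_start[OF t(2,3)] dist_start[OF s(2,3)] s(1) by simp
  then have lev: "q = p" if "q \<in> trace C" "d (\<alpha> 0) q = s" for q
    using level[OF that] s(1) t(1) by auto
  have p: "p \<in> trace C" using assms(1) trace_eq by auto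
  have "0 < s" "s < L" using neg s by (auto simp: less_le)
  moreover have "\<alpha> 0 \<in> trace C" "\<alpha> L \<in> trace C" using trace_eq length_nonneg by auto
  ultimately have "d (\<alpha> 0) (\<alpha> 0) < s \<longleftrightarrow> d (\<alpha> 0) (\<alpha> L) < s"
    using neg by (intro cycle_minus_point_connected[of "d (\<alpha> 0)" s p] dist_diff lev p start_in) auto
  then show False using \<open>0 < s\<close> \<open>s < L\<close> dist_start(1)[of L] start_in by simp
qed


text \<open>On an edge that leads from one side to the other, the last point of the first side
  belongs to both.\<close>

lemma edge_between_sides:
  assumes e: "e \<in> walk_edges C" and p: "p \<in> edge_points e" "p \<in> \<alpha> ` {0..L}"
    and q: "q \<in> edge_points e" "q \<in> \<beta> ` {0..L}"
  shows "\<exists>z\<in>{\<alpha> 0, \<alpha> L}. d p z \<le> edge_dist e p q"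
proof -
  obtain u v where uv: "e = {u, v}" "u \<noteq> v" using cyc.edgeE[OF e] by metis
  define a where "a = p v"
  define b where "b = q v"
  have pm: "p \<in> edge_points {u, v}" and qm: "q \<in> edge_points {u, v}" using p q uv by auto
  have a: "p = on_edge u v a" "0 \<le> a" "a \<le> 1"
    using edge_points_eq_on_edge(1-3)[OF uv(2) pm] by (simp_all add: a_def)
  have b: "q = on_edge u v b" "0 \<le> b" "b \<le> 1"
    using edge_points_eq_on_edge(1-3)[OF uv(2) qm] by (simp_all add: b_def)
  have eE: "{u, v} \<in> E" and eC: "{u, v} \<in> walk_edges C" using e uv cycle_edges by auto
  \<comment> \<open>The segment from \<open>p\<close> to \<open>q\<close>. A point of level \<open>f t\<close> is on a side if and only if it is
    the point of this side with parameter \<open>f t\<close>, and this is the vanishing of a continuous function.\<close>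
  define w where "w t = on_edge u v (a + t * (b - a))" for t
  have par: "0 \<le> a + t * (b - a)" "a + t * (b - a) \<le> 1" if "0 \<le> t" "t \<le> 1" for t
  proof -
    have "a + t * (b - a) = (1 - t) * a + t * b" by (simp add: algebra_simps)
    then show "0 \<le> a + t * (b - a)" "a + t * (b - a) \<le> 1"
      using a(2,3) b(2,3) that convex_bound_le[of a 1 b "1 - t" t] by auto
  qed
  have wC: "w t \<in> trace C" if "0 \<le> t" "t \<le> 1" for t
    using cyc.on_edge_in_points[OF eC par[OF that]] by (simp add: w_def trace_def)
  have wX: "w t \<in> X" if "0 \<le> t" "t \<le> 1" for t using wC[OF that] trace_subset by auto
  have wd: "d (w s) (w t) = \<bar>s - t\<bar> * \<bar>b - a\<bar>" if "0 \<le> s" "s \<le> 1" "0 \<le> t" "t \<le> 1" for s t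
    using dist_on_edge[OF eE par[OF that(1,2)] par[OF that(3,4)]]
    by (simp add: w_def flip: abs_mult left_diff_distrib)
  define f where "f t = d (\<alpha> 0) (w t)" for t
  have f: "0 \<le> f t" "f t \<le> L" "w t = \<alpha> (f t) \<or> w t = \<beta> (f t)" if "0 \<le> t" "t \<le> 1" for t
    using wC[OF that] trace_eq dist_start by (auto simp: f_def)
  have fd: "\<bar>f s - f t\<bar> \<le> d (w s) (w t)" if "0 \<le> s" "s \<le> 1" "0 \<le> t" "t \<le> 1" for s t
    unfolding f_def using dist_diff[OF wX[OF that(1,2)] wX[OF that(3,4)] start_in] .
  have lip: "\<bar>d (w s) (\<gamma> (f s)) - d (w t) (\<gamma> (f t))\<bar> \<le> 2 * \<bar>s - t\<bar>"
    if \<gamma>: "isometric_path X d \<gamma> L" and st: "0 \<le> s" "s \<le> 1" "0 \<le> t" "t \<le> 1" for \<gamma> s t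
  proof -
    have in': "\<gamma> (f s) \<in> X" "\<gamma> (f t) \<in> X" using isometric_path_mem[OF \<gamma>] f st by auto
    have fst: "d (\<gamma> (f s)) (\<gamma> (f t)) = \<bar>f s - f t\<bar>" using isometric_path_dist[OF \<gamma>] f st by auto
    have wst: "d (w s) (w t) \<le> \<bar>s - t\<bar>"
      using wd[OF st] a b mult_left_mono[of "\<bar>b - a\<bar>" 1 "\<bar>s - t\<bar>"] by simp
    have "\<bar>d (w s) (\<gamma> (f s)) - d (w t) (\<gamma> (f t))\<bar> \<le> d (w s) (w t) + d (\<gamma> (f s)) (\<gamma> (f t))"
      using dist_diff[OF wX[OF st(1,2)] wX[OF st(3,4)] in'(1)] dist_diff[OF in' wX[OF st(3,4)]]
        dist_commute[of "\<gamma> (f s)"] by (smt (verit))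
    also have "\<dots> \<le> \<bar>s - t\<bar> + \<bar>s - t\<bar>"
      using order_trans[OF fd[OF st] wst] fst wst by (intro add_mono) simp_all
    finally show ?thesis by simp
  qed
  define h where "h t = d (w t) (\<alpha> (f t))" for t
  have "continuous_on {0..1} h"
    unfolding h_def by (rule lipschitz_imp_continuous_on[of _ _ 2]) (use lip[OF \<alpha>] in auto)
  moreover have "h 0 = 0"
  proof -
    obtain s where "p = \<alpha> s" "0 \<le> s" "s \<le> L" using p(2) by auto
    moreover have "w 0 = p" using a(1) by (simp add: w_def)
    ultimately show ?thesis using dist_start wX[of 0] by (simp add: h_def f_def)
  qed
  ultimately obtain s where s: "0 \<le> s" "s \<le> 1" "h s = 0" "\<And>t. s < t \<Longrightarrow> t \<le> 1 \<Longrightarrow> h t \<noteq> 0"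
    using last_zero[of 0 1 h] by auto
  have w1: "w 1 = q" using b(1) by (simp add: w_def)
  have inA: "w s \<in> \<alpha> ` {0..L}"
    using s(3) dist_eq_0_iff[of "w s" "\<alpha> (f s)"] wX f isometric_path_mem[OF \<alpha>] s(1,2)
    by (auto simp: h_def)
  have inB: "w s \<in> \<beta> ` {0..L}"
  proof (cases "s = 1")
    case True
    then show ?thesis using q(2) w1 by simp
  next
    case False
    \<comment> \<open>The points after \<open>w s\<close> are on the second side, which is closed.\<close>
    have "d (w s) (\<beta> (f s)) \<le> 0"
    proof (rule field_le_epsilon)
      fix c :: real assume c: "0 < c"
      define t where "t = min 1 (s + c / 2)"
      have t: "s < t" "t \<le> 1" using False s c by (auto simp: t_def)
      have "t \<le> s + c / 2" unfolding t_def by (rule min.cobounded2)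
      have "d (w t) (w t) = 0" using dist_refl[OF wX[of t]] s t by simp
      moreover have "d (w t) (\<alpha> (f t)) \<noteq> 0" using s(4)[OF t(1,2)] by (simp add: h_def)
      ultimately have "w t \<noteq> \<alpha> (f t)" by metis
      then have "w t = \<beta> (f t)" using f(3)[of t] s t by auto
      then have "d (w t) (\<beta> (f t)) = 0" using dist_refl[OF wX[of t]] s t by simp
      then show "d (w s) (\<beta> (f s)) \<le> 0 + c" using lip[OF \<beta>, of s t] s t \<open>t \<le> s + c / 2\<close> by simp
    qed
    then have "w s = \<beta> (f s)"
      using dist_nonneg dist_eq_0_iff wX[OF s(1,2)] isometric_path_mem[OF \<beta> f(1,2)[OF s(1,2)]] by fastforce
    then show ?thesis using f(1,2)[OF s(1,2)] by auto
  qed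
  have "d p (w s) = s * \<bar>b - a\<bar>" using wd[of 0 s] s a(1) by (simp add: w_def)
  also have "\<dots> \<le> \<bar>b - a\<bar>" using s(2) s(1) mult_right_mono[of s 1 "\<bar>b - a\<bar>"] by simp
  also have "\<dots> = edge_dist e p q" using edge_dist_on_edge[OF uv(2), of a b] a(1) b(1) uv(1) by simp
  finally show ?thesis using sides_inter[OF inA inB] by auto
qed

text \<open>Consider the first step of the curve that ends on the second side.\<close>

lemma linked_between_sides:
  assumes "linked (set C) (walk_edges C) p q l" "p \<in> \<alpha> ` {0..L}" "q \<in> \<beta> ` {0..L}"
  shows "\<exists>z\<in>{\<alpha> 0, \<alpha> L}. d p z \<le> l"
  using assms
proof (induction rule: linked_edge_induct)
  case (refl p)
  then show ?case using sides_inter[of p] start_in end_in by auto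
next
  case (step e p q r l)
  have q: "q \<in> trace C"
    using cyc.edge_points_subset[OF step.hyps(1)] step.hyps(3) by (auto simp: trace_def)
  have l: "0 \<le> l" using cyc.linked_points(3)[OF step.hyps(4)] .
  show ?case
  proof (cases "q \<in> \<alpha> ` {0..L}")
    case True
    then obtain z where z: "z \<in> {\<alpha> 0, \<alpha> L}" "d q z \<le> l" using step.IH step.prems by blast
    have "e \<in> E" using step.hyps(1) cycle_edges by blast
    then have "d p q = edge_dist e p q" using dist_edge_points[OF _ step.hyps(2,3)] by simp
    moreover have "d p z \<le> d p q + d q z"
      using step.prems(1) True side_subset z(1) start_in end_in by (intro dist_triangle) auto
    ultimately show ?thesis using z by (intro bexI[of _ z]) auto
  next
    case False
    then have "q \<in> \<beta> ` {0..L}" using q trace_eq by auto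
    from edge_between_sides[OF step.hyps(1,2) step.prems(1) step.hyps(3) this]
    obtain z where "z \<in> {\<alpha> 0, \<alpha> L}" "d p z \<le> edge_dist e p q" by blast
    then show ?thesis using l by (intro bexI[of _ z]) simp_all
  qed
qed

lemma cycle_dist_between_sides:
  assumes "p \<in> \<alpha> ` {0..L}" "q \<in> \<beta> ` {0..L}"
  shows "min (d p (\<alpha> 0)) (d p (\<alpha> L)) \<le> cycle_dist C p q"
  unfolding cycle_dist_def
proof (rule cyc.dist_ge)
  show "p \<in> cyc.X" "q \<in> cyc.X" using assms trace_eq by (auto simp: trace_def)
  fix l assume "linked (set C) (walk_edges C) p q l"
  then show "min (d p (\<alpha> 0)) (d p (\<alpha> L)) \<le> l"
    using linked_between_sides[OF _ assms] by force
qed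

text \<open>Distinct vertices on one side have distances at least 1, so they lie on different
  unit intervals of levels.\<close>

lemma card_side: "real (card {a \<in> set C. vertex_point a \<in> \<alpha> ` {0..L}}) \<le> L + 1"
proof -
  let ?A = "{a \<in> set C. vertex_point a \<in> \<alpha> ` {0..L}}"
  let ?f = "\<lambda>a. nat \<lfloor>d (\<alpha> 0) (vertex_point a)\<rfloor>"
  have lev: "\<exists>s. 0 \<le> s \<and> s \<le> L \<and> vertex_point a = \<alpha> s \<and> d (\<alpha> 0) (vertex_point a) = s"
    if "a \<in> ?A" for a
    using that dist_start(1) by auto
  have "inj_on ?f ?A"
  proof (rule inj_onI, rule ccontr)
    fix a b assume ab: "a \<in> ?A" "b \<in> ?A" "?f a = ?f b" "a \<noteq> b"
    obtain s t where s: "0 \<le> s" "s \<le> L" "vertex_point a = \<alpha> s" "d (\<alpha> 0) (vertex_point a) = s"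
      and t: "0 \<le> t" "t \<le> L" "vertex_point b = \<alpha> t" "d (\<alpha> 0) (vertex_point b) = t"
      using lev[OF ab(1)] lev[OF ab(2)] by blast
    have "1 \<le> d (vertex_point a) (vertex_point b)"
      using dist_coordinate[of "vertex_point a" "vertex_point b" a] ab cycle_set
      by (auto simp: vertex_point_apply)
    also have "\<dots> = \<bar>s - t\<bar>" using isometric_path_dist[OF \<alpha> s(1,2) t(1,2)] s(3) t(3) by simp
    finally have "1 \<le> \<bar>s - t\<bar>" .
    moreover have "\<lfloor>s\<rfloor> = \<lfloor>t\<rfloor>" using ab(3) s(1,4) t(1,4) by (simp add: eq_nat_nat_iff)
    ultimately show False by linarith
  qed
  moreover have "?f ` ?A \<subseteq> {..nat \<lfloor>L\<rfloor>}"
    using lev by (force intro: nat_mono floor_mono)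
  ultimately have "card ?A \<le> card {..nat \<lfloor>L\<rfloor>}" by (rule card_inj_on_le) simp
  then have "real (card ?A) \<le> real (nat \<lfloor>L\<rfloor>) + 1" by simp
  also have "\<dots> \<le> L + 1" using length_nonneg by simp
  finally show ?thesis .
qed

lemma walk_length_le: "real (walk_length C) \<le> 2 * L + 2"
proof -
  interpret swapped: bigon_cycle V E C \<beta> \<alpha> L by (rule swap)
  let ?A = "{a \<in> set C. vertex_point a \<in> \<alpha> ` {0..L}}" and ?B = "{a \<in> set C. vertex_point a \<in> \<beta> ` {0..L}}"
  have "set C = ?A \<union> ?B" using vertex_point_in_trace trace_eq by auto
  then have "card (set C) \<le> card ?A + card ?B" using card_Un_le[of ?A ?B] by simp
  moreover have "card (set C) = walk_length C"
    using distinct_card[OF cycle_distinct] set_tl_cycle by (simp add: walk_length_def)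
  ultimately show ?thesis using card_side swapped.card_side by linarith
qed

end

section \<open>Stability yields shortcuts\<close>

text \<open>A walk of minimal length among those on the vertices of \<open>vs\<close> that lead from \<open>A\<close> to \<open>B\<close>.\<close>

lemma walk_between:
  assumes "walk V E vs" "hd vs \<in> A" "last vs \<in> B"
  obtains \<sigma> where "vertex_path V E \<sigma>" "hd \<sigma> \<in> A" "last \<sigma> \<in> B" "length \<sigma> \<le> length vs"
    "set \<sigma> \<subseteq> set vs" "\<And>u. u \<in> set \<sigma> \<Longrightarrow> u \<in> A \<Longrightarrow> u = hd \<sigma>"
    "\<And>u. u \<in> set \<sigma> \<Longrightarrow> u \<in> B \<Longrightarrow> u = last \<sigma>"
proof -
  let ?P = "\<lambda>\<sigma>. walk V E \<sigma> \<and> hd \<sigma> \<in> A \<and> last \<sigma> \<in> B \<and> set \<sigma> \<subseteq> set vs"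
  obtain \<sigma> where \<sigma>: "?P \<sigma>" and least: "\<And>ws. ?P ws \<Longrightarrow> length \<sigma> \<le> length ws"
    using ex_has_least_nat[of ?P vs length] assms by auto
  have "distinct \<sigma>"
  proof (rule ccontr)
    assume "\<not> distinct \<sigma>"
    then obtain xs ys zs y where s: "\<sigma> = xs @ [y] @ ys @ [y] @ zs" using not_distinct_decomp by blast
    have "walk_edges (xs @ y # zs) \<subseteq> walk_edges \<sigma>"
      using walk_edges_join[of xs y zs] walk_edges_join[of xs y "ys @ y # zs"]
        walk_edges_join[of "y # ys" y zs] s by auto
    moreover have "hd (xs @ y # zs) = hd \<sigma>" using s by (cases xs) auto
    ultimately have "?P (xs @ y # zs)" using \<sigma> s by (auto simp: walk_iff_edges)
    then show False using least s by fastforce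
  qed
  moreover have "u = hd \<sigma>" if "u \<in> set \<sigma>" "u \<in> A" for u
  proof -
    obtain xs ys where s: "\<sigma> = xs @ u # ys" using split_list[OF \<open>u \<in> set \<sigma>\<close>] by blast
    then have "?P (u # ys)" using \<sigma> that(2) walk_edges_join[of xs u ys] by (auto simp: walk_iff_edges)
    then have "xs = []" using least s by fastforce
    then show ?thesis using s by simp
  qed
  moreover have "u = last \<sigma>" if "u \<in> set \<sigma>" "u \<in> B" for u
  proof -
    obtain xs ys where s: "\<sigma> = xs @ u # ys" using split_list[OF \<open>u \<in> set \<sigma>\<close>] by blast
    have "hd (xs @ [u]) = hd \<sigma>" using s by (cases xs) auto
    then have "?P (xs @ [u])"
      using \<sigma> that(2) s walk_edges_join[of xs u ys] by (auto simp: walk_iff_edges)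
    then have "ys = []" using least s by fastforce
    then show ?thesis using s by simp
  qed
  moreover have "length \<sigma> \<le> length vs" using least assms by blast
  ultimately show ?thesis using that[of \<sigma>] \<sigma> by (simp add: vertex_path_def)
qed

lemma (in connected_graph) dist_on_walk:
  assumes "walk V E vs" "u \<in> set vs"
  shows "d (vertex_point (hd vs)) (vertex_point u) \<le> real (walk_length vs)"
proof -
  obtain xs ys where vs: "vs = xs @ u # ys" using split_list[OF assms(2)] by blast
  have "walk V E (xs @ [u])"
    using assms(1) vs walk_edges_join[of xs u ys] by (auto simp: walk_iff_edges)
  from dist_le_linked[OF linked_walk[OF this]]
  have "d (vertex_point (hd (xs @ [u]))) (vertex_point u) \<le> real (walk_length (xs @ [u]))" by simp
  moreover have "hd (xs @ [u]) = hd vs" using vs by (cases xs) auto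
  moreover have "walk_length (xs @ [u]) \<le> walk_length vs" using vs by (simp add: walk_length_def)
  ultimately show ?thesis by (metis of_nat_le_iff order_trans)
qed

context graph_cycle
begin

lemma near_cycle_vertex:
  assumes "p \<in> trace C"
  obtains a where "a \<in> set C" "cycle_dist C p (vertex_point a) \<le> 1"
proof -
  have p: "p \<in> cyc.X" using assms by (simp add: trace_def)
  obtain a where a: "a \<in> set C" "p a > 0" using cyc.support_nonempty[OF p] by blast
  then have "cycle_dist C p (vertex_point a) \<le> 1"
    using cyc.dist_to_support[OF p a(2)] by (simp add: cycle_dist_def)
  then show ?thesis using that a by blast
qed

text \<open>A point common to \<open>\<sigma>\<close> and the cycle which is not a vertex brings its whole edge into both. The
  ends of that edge would be the ends of \<open>\<sigma>\<close>, which are too far apart in the cycle.\<close>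

lemma shortcut_is_strict:
  assumes "shortcut V E C \<sigma>" "1 < cycle_dist C (vertex_point (hd \<sigma>)) (vertex_point (last \<sigma>))"
    and inter: "\<And>u. u \<in> set \<sigma> \<Longrightarrow> u \<in> set C \<Longrightarrow> u = hd \<sigma> \<or> u = last \<sigma>"
  shows "strict_shortcut V E C \<sigma>"
proof -
  have path: "walk V E \<sigma>" "hd \<sigma> \<in> set C" "last \<sigma> \<in> set C"
    using assms(1) by (auto simp: shortcut_def vertex_path_def)
  have ends: "hd \<sigma> \<in> set \<sigma>" "last \<sigma> \<in> set \<sigma>" using path(1) by (auto simp: walk_def)
  have "p \<in> shortcut_vertices \<sigma>" if p: "p \<in> trace \<sigma>" "p \<in> trace C" for p
  proof -
    consider u where "u \<in> set \<sigma>" "p = vertex_point u"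
      | e where "e \<in> walk_edges \<sigma>" "p \<in> edge_points e" "\<And>a. p \<noteq> vertex_point a"
    proof -
      consider u where "u \<in> set \<sigma>" "p = vertex_point u" | e where "e \<in> walk_edges \<sigma>" "p \<in> edge_points e"
        using p(1) by (auto simp: trace_def graph_points_def)
      moreover have "a \<in> set \<sigma>" if "e \<in> walk_edges \<sigma>" "p \<in> edge_points e" "p = vertex_point a" for e a
        using edge_points_pos_mem[OF that(2), of a] walk_edges_subset_set[OF that(1)] that(3)
        by (auto simp: vertex_point_apply)
      ultimately show ?thesis using that by metis
    qed
    then show ?thesis
    proof cases
      case 1
      then show ?thesis
        using inter[of u] p(2) vertex_point_in_trace by (auto simp: shortcut_vertices_def)
    next
      case 2
      have eE: "e \<in> E" using 2(1) path(1) by (auto simp: walk_iff_edges)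
      have eC: "e \<in> walk_edges C" by (rule trace_edge[OF p(2) eE 2(2,3)])
      obtain u v where uv: "e = {u, v}" "u \<noteq> v" using edgeE[OF eE] by metis
      have uC: "u \<in> set C" "v \<in> set C" using cyc.edge_verts[of u v] eC uv by auto
      have "u \<in> set \<sigma>" "v \<in> set \<sigma>" using walk_edges_subset_set[OF 2(1)] uv by auto
      then have "{u, v} = {hd \<sigma>, last \<sigma>}" using inter uC uv(2) by blast
      then have "cycle_dist C (vertex_point (hd \<sigma>)) (vertex_point (last \<sigma>)) = 1"
        using cyc.dist_on_edge[of "hd \<sigma>" "last \<sigma>" 0 1] eC uv(1) by (simp add: cycle_dist_def)
      then show ?thesis using assms(2) by simp
    qed
  qed
  moreover have "shortcut_vertices \<sigma> \<subseteq> trace \<sigma> \<inter> trace C"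
    using path(2,3) ends by (auto simp: shortcut_vertices_def trace_def graph_points_def)
  ultimately show ?thesis using assms(1) by (auto simp: strict_shortcut_def)
qed

end

context bigon_cycle
begin

text \<open>The point of the other side within \<open>R + 1\<close> of \<open>a\<close> has a vertex of that side within distance 1,
  so a walk of length less than \<open>R + 2\<close> leads from \<open>a\<close> to the other side. Inside it, a minimal walk
  \<open>\<sigma>\<close> between the sides starts within \<open>R + 2\<close> of \<open>a\<close>, hence at distance more than \<open>R + 2\<close> from both ends
  of the bigon. Within the cycle, the ends of \<open>\<sigma>\<close> are therefore further apart than \<open>\<sigma>\<close> is long.\<close>

lemma strict_shortcut_near:
  assumes R: "0 \<le> R"
    and close: "\<And>s. 0 \<le> s \<Longrightarrow> s \<le> L \<Longrightarrow> \<exists>t. 0 \<le> t \<and> t \<le> L \<and> d (\<alpha> s) (\<beta> t) < R + 1"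
    and a: "a \<in> set C" "vertex_point a \<in> \<alpha> ` {0..L}"
    and far: "2 * (R + 2) < d (vertex_point a) (\<alpha> 0)" "2 * (R + 2) < d (vertex_point a) (\<alpha> L)"
  shows "\<exists>\<sigma>. strict_shortcut V E C \<sigma> \<and> real (walk_length \<sigma>) < R + 2 \<and>
    cycle_dist C (vertex_point a) (vertex_point (hd \<sigma>)) < R + 2"
proof -
  let ?A = "{u \<in> set C. vertex_point u \<in> \<alpha> ` {0..L}}"
  let ?B = "{u \<in> set C. vertex_point u \<in> \<beta> ` {0..L}}"
  interpret swapped: bigon_cycle V E C \<beta> \<alpha> L by (rule swap)
  have vX: "vertex_point u \<in> X" if "u \<in> set C" for u using that cycle_set by auto
  obtain s where s: "0 \<le> s" "s \<le> L" "vertex_point a = \<alpha> s" using a(2) by auto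
  obtain t where t: "0 \<le> t" "t \<le> L" "d (vertex_point a) (\<beta> t) < R + 1" using close[OF s(1,2)] s(3) by auto
  define q where "q = \<beta> t"
  have q: "q \<in> \<beta> ` {0..L}" "q \<in> trace C" using t trace_eq by (auto simp: q_def)
  have qX: "q \<in> X" using q(2) trace_subset by auto
  obtain b where b: "b \<in> set C" "cycle_dist C q (vertex_point b) \<le> 1" using near_cycle_vertex[OF q(2)] .
  have qb: "d q (vertex_point b) \<le> 1"
    using dist_le_cycle_dist[OF q(2), of "vertex_point b"] b vertex_point_in_trace by fastforce
  \<comment> \<open>Otherwise an end of the bigon would be within distance 1 of \<open>q\<close>, and so too close to \<open>a\<close>.\<close>
  have "vertex_point b \<in> \<beta> ` {0..L}"
  proof (rule ccontr)
    assume "vertex_point b \<notin> \<beta> ` {0..L}"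
    then have "vertex_point b \<in> \<alpha> ` {0..L}" using b(1) vertex_point_in_trace trace_eq by auto
    from swapped.cycle_dist_between_sides[OF q(1) this]
    have "d q (\<alpha> 0) \<le> 1 \<or> d q (\<alpha> L) \<le> 1" using b(2) start_eq end_eq by auto
    then show False
      using dist_triangle[OF vX[OF a(1)] qX start_in] dist_triangle[OF vX[OF a(1)] qX end_in] t(3) far R
      unfolding q_def by (smt (verit))
  qed
  then have bB: "b \<in> ?B" using b(1) by simp
  have "d (vertex_point a) (vertex_point b) < R + 2"
    using dist_triangle[OF vX[OF a(1)] qX vX[OF b(1)]] qb t(3) unfolding q_def by linarith
  then obtain vs where vs: "walk V E vs" "hd vs = a" "last vs = b" "real (walk_length vs) < R + 2"
    using dist_imp_walk[of a b] a(1) b(1) cycle_set by blast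
  obtain \<sigma> where \<sigma>: "vertex_path V E \<sigma>" "hd \<sigma> \<in> ?A" "last \<sigma> \<in> ?B" "length \<sigma> \<le> length vs"
    "set \<sigma> \<subseteq> set vs" "\<And>u. u \<in> set \<sigma> \<Longrightarrow> u \<in> ?A \<Longrightarrow> u = hd \<sigma>"
    "\<And>u. u \<in> set \<sigma> \<Longrightarrow> u \<in> ?B \<Longrightarrow> u = last \<sigma>"
    using walk_between[OF vs(1), of ?A ?B] vs(2,3) a bB by blast
  have len: "real (walk_length \<sigma>) < R + 2"
    using \<sigma>(4) vs(4) by (simp add: walk_length_def)
  have "hd \<sigma> \<in> set vs" using \<sigma>(1,5) by (auto simp: vertex_path_def walk_def)
  then have near: "d (vertex_point a) (vertex_point (hd \<sigma>)) < R + 2"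
    using dist_on_walk[OF vs(1)] vs(2,4) by fastforce
  have hX: "vertex_point (hd \<sigma>) \<in> X" using vX \<sigma>(2) by blast
  have "R + 2 < d (vertex_point (hd \<sigma>)) (\<alpha> 0)"
    using dist_triangle[OF vX[OF a(1)] hX start_in] near far(1) by (smt (verit))
  moreover have "R + 2 < d (vertex_point (hd \<sigma>)) (\<alpha> L)"
    using dist_triangle[OF vX[OF a(1)] hX end_in] near far(2) by (smt (verit))
  moreover have "min (d (vertex_point (hd \<sigma>)) (\<alpha> 0)) (d (vertex_point (hd \<sigma>)) (\<alpha> L))
      \<le> cycle_dist C (vertex_point (hd \<sigma>)) (vertex_point (last \<sigma>))"
    using \<sigma>(2,3) by (intro cycle_dist_between_sides) auto
  ultimately have long: "R + 2 < cycle_dist C (vertex_point (hd \<sigma>)) (vertex_point (last \<sigma>))" by linarith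
  have "strict_shortcut V E C \<sigma>"
  proof (rule shortcut_is_strict)
    show "shortcut V E C \<sigma>" using \<sigma>(1-3) len long by (auto simp: shortcut_def)
    show "1 < cycle_dist C (vertex_point (hd \<sigma>)) (vertex_point (last \<sigma>))" using long R by linarith
    fix u assume u: "u \<in> set \<sigma>" "u \<in> set C"
    then have "u \<in> ?A \<or> u \<in> ?B" using vertex_point_in_trace trace_eq by auto
    then show "u = hd \<sigma> \<or> u = last \<sigma>" using \<sigma>(6,7) u(1) by blast
  qed
  moreover have "cycle_dist C (vertex_point a) (vertex_point (hd \<sigma>)) < R + 2"
  proof -
    obtain r where r: "0 \<le> r" "r \<le> L" "vertex_point (hd \<sigma>) = \<alpha> r" using \<sigma>(2) by auto
    have "cycle_dist C (\<alpha> s) (\<alpha> r) \<le> \<bar>s - r\<bar>"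
      using trace_eq by (intro cycle_dist_isometric_path[OF \<alpha> _ s(1,2) r(1,2)]) auto
    then show ?thesis using near isometric_path_dist[OF \<alpha> s(1,2) r(1,2)] s(3) r(3) by simp
  qed
  ultimately show ?thesis using len by blast
qed

text \<open>Sliding along its side by at most \<open>M\<close>, the point reaches distance \<open>M\<close> from both ends; going on
  to a vertex costs at most 1.\<close>

lemma far_vertex_near:
  assumes M: "0 \<le> M" "2 * M \<le> L" and s: "0 \<le> s" "s \<le> L"
  shows "\<exists>a\<in>set C. cycle_dist C (vertex_point a) (\<alpha> s) \<le> M + 1 \<and>
    M - 1 \<le> d (vertex_point a) (\<alpha> 0) \<and> M - 1 \<le> d (vertex_point a) (\<alpha> L)"
proof -
  define t where "t = max M (min s (L - M))"
  have t: "0 \<le> t" "t \<le> L" "M \<le> t" "t \<le> L - M" "\<bar>t - s\<bar> \<le> M"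
    using M s by (auto simp: t_def max_def min_def)
  have mem: "\<alpha> s \<in> trace C" "\<alpha> t \<in> trace C" using s t trace_eq by auto
  obtain a where a: "a \<in> set C" "cycle_dist C (\<alpha> t) (vertex_point a) \<le> 1"
    using near_cycle_vertex[OF mem(2)] .
  have va: "vertex_point a \<in> trace C" using a(1) vertex_point_in_trace by simp
  have tX: "\<alpha> t \<in> X" and aX: "vertex_point a \<in> X" using mem(2) va trace_subset by auto
  have ta: "d (\<alpha> t) (vertex_point a) \<le> 1" using dist_le_cycle_dist[OF mem(2) va] a(2) by simp
  have "cycle_dist C (\<alpha> t) (\<alpha> s) \<le> \<bar>t - s\<bar>"
    using trace_eq by (intro cycle_dist_isometric_path[OF \<alpha> _ t(1,2) s]) auto
  moreover have "cycle_dist C (vertex_point a) (\<alpha> s) \<le>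
      cycle_dist C (\<alpha> t) (vertex_point a) + cycle_dist C (\<alpha> t) (\<alpha> s)"
    using cyc.dist_triangle[of "vertex_point a" "\<alpha> t" "\<alpha> s"] cyc.dist_commute[of "\<alpha> t" "vertex_point a"]
      mem va by (simp add: cycle_dist_def trace_def)
  moreover have "d (\<alpha> 0) (\<alpha> t) = t" "d (\<alpha> t) (\<alpha> L) = L - t" using dist_start t by auto
  moreover have "d (\<alpha> 0) (\<alpha> t) \<le> d (vertex_point a) (\<alpha> 0) + d (\<alpha> t) (vertex_point a)"
    "d (\<alpha> t) (\<alpha> L) \<le> d (\<alpha> t) (vertex_point a) + d (vertex_point a) (\<alpha> L)"
    using dist_triangle[OF start_in aX tX] dist_triangle[OF tX aX end_in]
      dist_commute[of "\<alpha> 0"] dist_commute[of "\<alpha> t" "vertex_point a"] by simp_all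
  ultimately show ?thesis using a t ta by (intro bexI[OF _ a(1)]) linarith
qed

text \<open>A point slides by at most \<open>2 * R + 6\<close> and then moves by at most 1 to reach a vertex at distance at
  least \<open>2 * (R + 2) + 1\<close> from the ends; from there a shortcut vertex is less than \<open>R + 2\<close> away. This
  gives the density \<open>3 * R + 9\<close>.\<close>

lemma dense_shortcuts:
  assumes R: "0 \<le> R"
    and close\<alpha>: "\<And>s. 0 \<le> s \<Longrightarrow> s \<le> L \<Longrightarrow> \<exists>t. 0 \<le> t \<and> t \<le> L \<and> d (\<alpha> s) (\<beta> t) < R + 1"
    and close\<beta>: "\<And>s. 0 \<le> s \<Longrightarrow> s \<le> L \<Longrightarrow> \<exists>t. 0 \<le> t \<and> t \<le> L \<and> d (\<beta> s) (\<alpha> t) < R + 1"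
    and long: "4 * (R + 3) \<le> L"
  shows "\<exists>\<Sigma>. finite \<Sigma> \<and> (\<forall>\<sigma>\<in>\<Sigma>. strict_shortcut V E C \<sigma> \<and> real (walk_length \<sigma>) < R + 2) \<and>
    dense_subset (3 * R + 9) (trace C) (cycle_dist C) (\<Union>\<sigma>\<in>\<Sigma>. shortcut_vertices \<sigma>)"
proof -
  interpret swapped: bigon_cycle V E C \<beta> \<alpha> L by (rule swap)
  define good where "good a \<sigma> \<longleftrightarrow> strict_shortcut V E C \<sigma> \<and> real (walk_length \<sigma>) < R + 2 \<and>
    cycle_dist C (vertex_point a) (vertex_point (hd \<sigma>)) < R + 2" for a \<sigma>
  define \<Sigma> where "\<Sigma> = (\<lambda>a. SOME \<sigma>. good a \<sigma>) ` {a \<in> set C. \<exists>\<sigma>. good a \<sigma>}"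
  have good: "good a (SOME \<sigma>. good a \<sigma>)" if "\<exists>\<sigma>. good a \<sigma>" for a
    using that by (rule someI_ex)
  have \<Sigma>: "strict_shortcut V E C \<sigma>" "real (walk_length \<sigma>) < R + 2" if "\<sigma> \<in> \<Sigma>" for \<sigma>
    using that good unfolding \<Sigma>_def good_def by auto
  have ex: "\<exists>\<sigma>. good a \<sigma>" if "a \<in> set C"
    "2 * (R + 2) + 1 \<le> d (vertex_point a) (\<alpha> 0)" "2 * (R + 2) + 1 \<le> d (vertex_point a) (\<alpha> L)" for a
  proof -
    have "vertex_point a \<in> \<alpha> ` {0..L} \<or> vertex_point a \<in> \<beta> ` {0..L}"
      using that(1) vertex_point_in_trace trace_eq by auto
    then show ?thesis
      using strict_shortcut_near[OF R close\<alpha> that(1)] swapped.strict_shortcut_near[OF R close\<beta> that(1)]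
        that(2,3) start_eq end_eq unfolding good_def by fastforce
  qed
  have "\<exists>q\<in>\<Union>\<sigma>\<in>\<Sigma>. shortcut_vertices \<sigma>. cycle_dist C q p < 3 * R + 9" if p: "p \<in> trace C" for p
  proof -
    have L: "2 * (2 * R + 6) \<le> L" "0 \<le> 2 * R + 6" using long R by auto
    obtain s where s: "0 \<le> s" "s \<le> L" "p = \<alpha> s \<or> p = \<beta> s" using p trace_eq by auto
    then have "\<exists>a\<in>set C. cycle_dist C (vertex_point a) p \<le> (2 * R + 6) + 1 \<and>
      (2 * R + 6) - 1 \<le> d (vertex_point a) (\<alpha> 0) \<and> (2 * R + 6) - 1 \<le> d (vertex_point a) (\<alpha> L)"
      using far_vertex_near[OF L(2,1) s(1,2)] swapped.far_vertex_near[OF L(2,1) s(1,2)] start_eq end_eq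
      by auto
    then obtain a where a: "a \<in> set C" "cycle_dist C (vertex_point a) p \<le> (2 * R + 6) + 1"
      "(2 * R + 6) - 1 \<le> d (vertex_point a) (\<alpha> 0)" "(2 * R + 6) - 1 \<le> d (vertex_point a) (\<alpha> L)"
      by blast
    have exa: "\<exists>\<sigma>. good a \<sigma>" using a by (intro ex) auto
    define \<sigma> where "\<sigma> = (SOME \<sigma>. good a \<sigma>)"
    have \<sigma>: "good a \<sigma>" "\<sigma> \<in> \<Sigma>" using good[OF exa] exa a(1) by (auto simp: \<sigma>_def \<Sigma>_def)
    have "hd \<sigma> \<in> set C" using \<sigma>(1) by (auto simp: good_def strict_shortcut_def shortcut_def)
    then have "cycle_dist C (vertex_point (hd \<sigma>)) p \<le>
        cycle_dist C (vertex_point a) (vertex_point (hd \<sigma>)) + cycle_dist C (vertex_point a) p"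
      using cyc.dist_triangle[of "vertex_point (hd \<sigma>)" "vertex_point a" p]
        cyc.dist_commute[of "vertex_point (hd \<sigma>)" "vertex_point a"] a(1) p
      by (simp add: cycle_dist_def trace_def)
    also have "\<dots> < 3 * R + 9" using \<sigma>(1) a(2) by (simp add: good_def)
    finally show ?thesis using \<sigma>(2)
      by (intro bexI[of _ "vertex_point (hd \<sigma>)"]) (auto simp: shortcut_vertices_def)
  qed
  moreover have "shortcut_vertices \<sigma> \<subseteq> trace C" if "\<sigma> \<in> \<Sigma>" for \<sigma>
    using \<Sigma>(1)[OF that] by (auto simp: strict_shortcut_def)
  moreover have "finite \<Sigma>" by (simp add: \<Sigma>_def)
  ultimately show ?thesis using \<Sigma> by (intro exI[of _ \<Sigma>]) (auto simp: dense_subset_def)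
qed

end

section \<open>The course of a geodesic\<close>

context connected_graph
begin

lemma on_edge_cases:
  assumes "p \<in> X"
  obtains w where "w \<in> V" "p = vertex_point w"
  | a b where "{a, b} \<in> E" "p = on_edge a b (p b)" "0 < p a" "0 < p b" "p a + p b = 1"
proof (cases "\<exists>w. p = vertex_point w")
  case True
  then show ?thesis using that(1) assms by auto
next
  case False
  then obtain e where e: "e \<in> E" "p \<in> edge_points e" using assms by (metis graph_pointsE)
  then obtain a b where ab: "e = {a, b}" "a \<noteq> b" using edgeE by metis
  have pm: "p \<in> edge_points {a, b}" using e ab by simp
  have "p a \<noteq> 0" "p b \<noteq> 0"
    using edge_points_eq_opposite_vertex[of a b p] edge_points_eq_opposite_vertex[of b a p] pm False ab(2)
    by (auto simp: insert_commute)
  moreover have "0 \<le> p a" "0 \<le> p b" using pm by (auto simp: edge_points_def)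
  ultimately show ?thesis
    using that(2)[of a b] e ab edge_points_eq_on_edge(1,4)[OF ab(2) pm] by simp
qed

text \<open>If the coordinate of \<open>p\<close> at \<open>u\<close> is positive, \<open>p\<close> is on an edge at \<open>u\<close>. Otherwise \<open>h = 1\<close>, and short
  curves give walks to \<open>u\<close> with at least one edge which start at a vertex \<open>b\<close> in the support of \<open>p\<close>.
  As their length plus \<open>1 - p b\<close> comes arbitrarily close to 1, the point \<open>p\<close> is a neighbour of \<open>u\<close>.\<close>

lemma point_near_vertex:
  assumes "u \<in> V" "p \<in> X" "d (vertex_point u) p = h" "0 < h" "h \<le> 1"
  shows "\<exists>v. {u, v} \<in> E \<and> p = on_edge u v h"
proof (cases "p u > 0")
  case True
  have h: "1 - p u = h" using dist_to_support[OF assms(2) True] assms(3) dist_commute by metis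
  from assms(2) show ?thesis
  proof (cases rule: on_edge_cases)
    case (1 w)
    then have "p u = 1" using True by (auto simp: vertex_point_apply split: if_splits)
    then show ?thesis using h assms(4) by simp
  next
    case (2 a b)
    have n: "a \<noteq> b" using edge_neq 2(1) by blast
    have "u = a \<or> u = b" using True 2(2) on_edge_other[of u a b "p b"] by (metis less_irrefl)
    then show ?thesis
    proof
      assume u: "u = a"
      then have "h = p b" using 2(5) h by simp
      then show ?thesis using 2(1,2) u by (intro exI[of _ b]) simp
    next
      assume u: "u = b"
      have "p = on_edge b a (1 - p b)" using 2(2) on_edge_commute[of a b "p b"] by simp
      then show ?thesis using 2(1) h u by (intro exI[of _ a]) (auto simp: insert_commute)
    qed
  qed
next
  case False
  then have pu: "p u = 0" using graph_points_coordinate(1)[OF assms(2), of u] by simp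
  then have h: "h = 1"
    using dist_coordinate[of "vertex_point u" p u] assms by (simp add: vertex_point_apply)
  have walks: "\<exists>vs. walk V E vs \<and> last vs = u \<and> p (hd vs) > 0 \<and> 1 \<le> walk_length vs \<and>
      real (walk_length vs) + (1 - p (hd vs)) < c" if "1 < c" for c
  proof -
    have "d p (vertex_point u) < c" using assms(3) h that dist_commute by metis
    then obtain l where l: "linked V E p (vertex_point u) l" "l < c"
      using dist_less_linked[OF assms(2)] assms(1) by (metis vertex_point_in_points)
    from linked_imp_walk[OF l(1) HOL.refl] obtain vs where vs: "walk V E vs" "last vs = u"
      "p (hd vs) > 0" "real (walk_length vs) + (1 - p (hd vs)) \<le> l" by blast
    have "hd vs \<noteq> last vs" using vs(2,3) pu by auto
    then have "1 \<le> walk_length vs" using vs(1) by (cases vs; cases "tl vs") (auto simp: walk_def walk_length_def)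
    then show ?thesis using vs l(2) by (intro exI[of _ vs]) auto
  qed
  from assms(2) show ?thesis
  proof (cases rule: on_edge_cases)
    \<comment> \<open>A bound below 2 leaves walks of one edge only; for a point inside an edge, the bound
      \<open>1 + min (p a) (p b)\<close> leaves none.\<close>
    case (1 w)
    obtain vs where vs: "walk V E vs" "last vs = u" "p (hd vs) > 0" "1 \<le> walk_length vs"
      "real (walk_length vs) + (1 - p (hd vs)) < 2" using walks[of 2] by auto
    have "hd vs = w" using vs(3) 1 by (auto simp: vertex_point_apply split: if_splits)
    moreover have "length vs = 2" using vs(4,5) \<open>hd vs = w\<close> 1 by (simp add: walk_length_def vertex_point_apply)
    ultimately have "vs = [w, u]" using vs(2)
      by (auto simp: length_Suc_conv numeral_2_eq_2)
    then have "{u, w} \<in> E" using vs(1) by (simp add: walk_def insert_commute)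
    then show ?thesis using 1 h by auto
  next
    case (2 a b)
    obtain vs where vs: "p (hd vs) > 0" "1 \<le> walk_length vs"
      "real (walk_length vs) + (1 - p (hd vs)) < 1 + min (p a) (p b)"
      using walks[of "1 + min (p a) (p b)"] 2 by auto
    have "hd vs = a \<or> hd vs = b" using vs(1) 2(2) on_edge_other[of "hd vs" a b "p b"] by (metis less_irrefl)
    then show ?thesis using vs(2,3) 2(5) by auto
  qed
qed

text \<open>At time \<open>h\<close> the path is on some edge at \<open>u\<close>; let \<open>v\<close> be its other end. The coordinate at \<open>v\<close> is then \<open>h\<close>, and
  being 1-Lipschitz it was positive at all earlier times after \<open>0\<close>, so that the path was on the
  same edge.\<close>

lemma isometric_path_from_vertex:
  assumes \<gamma>: "isometric_path X d \<gamma> L" and s: "0 \<le> s" "s + h \<le> L" and h: "0 < h" "h \<le> 1"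
    and u: "\<gamma> s = vertex_point u"
  obtains v where "{u, v} \<in> E" "\<And>t. 0 \<le> t \<Longrightarrow> t \<le> h \<Longrightarrow> \<gamma> (s + t) = on_edge u v t"
proof -
  have mem: "\<gamma> (s + t) \<in> X" if "0 \<le> t" "t \<le> h" for t
    using isometric_path_mem[OF \<gamma>, of "s + t"] that s h by auto
  have uV: "u \<in> V" using mem[of 0] u h by simp
  have near: "\<exists>v. {u, v} \<in> E \<and> \<gamma> (s + t) = on_edge u v t" if "0 < t" "t \<le> h" for t
    using point_near_vertex[OF uV mem, of t t] isometric_path_dist[OF \<gamma>, of s "s + t"] that s h u by auto
  obtain v where v: "{u, v} \<in> E" "\<gamma> (s + h) = on_edge u v h" using near[of h] h by auto
  have uv: "u \<noteq> v" using v(1) edge_neq by auto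
  have "\<gamma> (s + t) = on_edge u v t" if t: "0 \<le> t" "t \<le> h" for t
  proof (cases "t = 0")
    case True
    then show ?thesis using u by simp
  next
    case False
    then obtain v' where v': "{u, v'} \<in> E" "\<gamma> (s + t) = on_edge u v' t" using near[of t] t by auto
    have "\<bar>\<gamma> (s + t) v - \<gamma> (s + h) v\<bar> \<le> h - t"
      using dist_coordinate[OF mem[OF t] mem[of h], of v] isometric_path_dist[OF \<gamma>, of "s + t" "s + h"] t s h
      by simp
    then have "0 < on_edge u v' t v" using v(2) v'(2) uv t False by simp
    then have "v = v'" using on_edge_other[of v u v' t] uv by fastforce
    then show ?thesis using v' by simp
  qed
  then show ?thesis using that v(1) by blast
qed

lemma isometric_path_to_vertex:
  assumes \<gamma>: "isometric_path X d \<gamma> L" and s: "h \<le> s" "s \<le> L" and h: "0 < h" "h \<le> 1"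
    and u: "\<gamma> s = vertex_point u"
  obtains v where "{u, v} \<in> E" "\<And>t. 0 \<le> t \<Longrightarrow> t \<le> h \<Longrightarrow> \<gamma> (s - t) = on_edge u v t"
proof -
  obtain v where v: "{u, v} \<in> E" "\<And>t. 0 \<le> t \<Longrightarrow> t \<le> h \<Longrightarrow> \<gamma> (L - ((L - s) + t)) = on_edge u v t"
    using isometric_path_from_vertex[OF isometric_path_reverse[OF \<gamma>], of "L - s" h u] s h u by auto
  have "\<gamma> (s - t) = on_edge u v t" if "0 \<le> t" "t \<le> h" for t
    using v(2)[OF that] by (simp add: algebra_simps)
  then show ?thesis using that v(1) by blast
qed

lemma edge_of_support:
  assumes "p \<in> X" "0 < p a" "0 < p b" "a \<noteq> b"
  shows "p \<in> edge_points {a, b}" "p a + p b = 1"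
proof -
  have "p \<in> edge_points {a, b} \<and> p a + p b = 1"
    using assms(1)
  proof (cases rule: on_edge_cases)
    case (1 w)
    then show ?thesis using assms(2-4) by (auto simp: vertex_point_apply split: if_splits)
  next
    case (2 a' b')
    have "a \<in> {a', b'}" "b \<in> {a', b'}"
      using on_edge_other[of a a' b' "p b'"] on_edge_other[of b a' b' "p b'"] 2(2) assms(2,3)
      by (metis insertCI less_irrefl)+
    then have ab: "a = a' \<and> b = b' \<or> a = b' \<and> b = a'" using assms(4) by auto
    have "on_edge a' b' (p b') \<in> edge_points {a', b'}"
      using 2 by (intro on_edge_mem edge_neq) auto
    then have "p \<in> edge_points {a', b'}" using 2(2) by simp
    then show ?thesis using ab 2(5) by (auto simp: insert_commute)
  qed
  then show "p \<in> edge_points {a, b}" "p a + p b = 1" by auto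
qed

text \<open>Two inner points of one edge have distance less than 1, so a geodesic of length at least 1 that
  starts inside an edge leaves it; when the smaller of the two coordinates of this edge vanishes for
  the first time, the geodesic is at an end of the edge.\<close>

lemma isometric_path_first_vertex:
  assumes \<gamma>: "isometric_path X d \<gamma> L" and L: "1 \<le> L"
  obtains s u where "0 < s" "s \<le> 1" "\<gamma> s = vertex_point u"
proof -
  have mem: "\<gamma> t \<in> X" if "0 \<le> t" "t \<le> L" for t using isometric_path_mem[OF \<gamma> that] .
  from mem[of 0] L have "\<gamma> 0 \<in> X" by simp
  then show ?thesis
  proof (cases rule: on_edge_cases)
    case (1 w)
    obtain v where "\<And>t. 0 \<le> t \<Longrightarrow> t \<le> 1 \<Longrightarrow> \<gamma> (0 + t) = on_edge w v t"
      using isometric_path_from_vertex[OF \<gamma>, of 0 1 w] 1 L by auto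
    from this[of 1] show ?thesis using that[of 1 v] by simp
  next
    case (2 a b)
    have ab: "a \<noteq> b" using 2(1) edge_neq by blast
    define g where "g t = min (\<gamma> t a) (\<gamma> t b)" for t
    have coord: "\<bar>\<gamma> s w - \<gamma> t w\<bar> \<le> \<bar>s - t\<bar>" if "0 \<le> s" "s \<le> L" "0 \<le> t" "t \<le> L" for s t w
      using dist_coordinate[OF mem[OF that(1,2)] mem[OF that(3,4)], of w]
        isometric_path_dist[OF \<gamma> that] by simp
    have "continuous_on {0..1} g"
    proof (rule lipschitz_imp_continuous_on[of _ _ 1])
      fix s t :: real assume "s \<in> {0..1}" "t \<in> {0..1}"
      then show "\<bar>g s - g t\<bar> \<le> 1 * \<bar>s - t\<bar>"
        using coord[of s t a] coord[of s t b] L unfolding g_def by (auto simp: min_def)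
    qed simp
    moreover have "g 1 = 0"
    proof (rule ccontr)
      assume "g 1 \<noteq> 0"
      then have "0 < \<gamma> 1 a" "0 < \<gamma> 1 b"
        using graph_points_coordinate(1)[OF mem[of 1]] L unfolding g_def
        by (smt (verit))+
      then have "\<gamma> 1 a + \<gamma> 1 b = 1" "\<gamma> 1 \<in> edge_points {a, b}"
        using edge_of_support[OF mem[of 1] _ _ ab] L by simp_all
      moreover have "\<gamma> 0 \<in> edge_points {a, b}" using on_edge_mem[OF ab, of "\<gamma> 0 b"] 2 by simp
      ultimately have "d (\<gamma> 0) (\<gamma> 1) = \<bar>\<gamma> 0 b - \<gamma> 1 b\<bar>"
        using edge_points_eq_on_edge[OF ab, of "\<gamma> 0"] edge_points_eq_on_edge[OF ab, of "\<gamma> 1"]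
          dist_on_edge[OF 2(1), of "\<gamma> 0 b" "\<gamma> 1 b"] by metis
      moreover have "d (\<gamma> 0) (\<gamma> 1) = 1" using isometric_path_dist[OF \<gamma>, of 0 1] L by simp
      ultimately show False
        using 2(3-5) \<open>0 < \<gamma> 1 a\<close> \<open>0 < \<gamma> 1 b\<close> \<open>\<gamma> 1 a + \<gamma> 1 b = 1\<close> by linarith
    qed
    ultimately obtain s where s: "0 \<le> s" "s \<le> 1" "g s = 0" "\<And>t. 0 \<le> t \<Longrightarrow> t < s \<Longrightarrow> g t \<noteq> 0"
      using first_zero[of 0 1 g] by auto
    have s0: "0 < s" using s(1,3) 2(3,4) by (cases "s = 0") (auto simp: g_def)
    have "\<bar>\<gamma> s a + \<gamma> s b - 1\<bar> \<le> 0"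
    proof (rule field_le_epsilon)
      fix c :: real assume c: "0 < c"
      define t where "t = max 0 (s - c / 2)"
      have t: "0 \<le> t" "t < s" using s0 c by (auto simp: t_def)
      have "s - c / 2 \<le> t" unfolding t_def by (rule max.cobounded2)
      have "0 < \<gamma> t a" "0 < \<gamma> t b"
        using s(4)[OF t] graph_points_coordinate(1)[OF mem[of t]] t s(2) L unfolding g_def
        by (smt (verit))+
      then have "\<gamma> t a + \<gamma> t b = 1" using edge_of_support[OF mem[of t] _ _ ab] t s(2) L by simp
      then show "\<bar>\<gamma> s a + \<gamma> s b - 1\<bar> \<le> 0 + c"
        using coord[of s t a] coord[of s t b] t s L \<open>s - c / 2 \<le> t\<close> by (smt (verit) field_sum_of_halves)
    qed
    then have "\<gamma> s a = 1 \<or> \<gamma> s b = 1" using s(3) unfolding g_def by (smt (verit))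
    then obtain w where "\<gamma> s w = 1" by blast
    then have "\<gamma> s = vertex_point w" using graph_points_eq_vertex_point(1)[OF mem[of s]] s L by simp
    then show ?thesis using that s0 s(2) by blast
  qed
qed

text \<open>From its first vertex at time \<open>s > 0\<close> on, a geodesic traverses a full edge per unit of time, so the
  vertices \<open>us\<close> strictly inside it are at times \<open>s\<close>, \<open>s + 1\<close> and so on. An end of the geodesic that is
  itself a vertex is not in \<open>us\<close>; then \<open>s = 1\<close> or \<open>s' = 1\<close>.\<close>

lemma isometric_path_vertices:
  assumes \<gamma>: "isometric_path X d \<gamma> L" and L: "1 < L"
  obtains us v v' s s' where "us \<noteq> []" "walk V E us" "distinct us" "L \<le> real (length us) + 1"
    "\<And>u. u \<in> set us \<Longrightarrow> \<exists>t. 0 < t \<and> t < L \<and> \<gamma> t = vertex_point u"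
    "{hd us, v} \<in> E" "0 < s" "s \<le> 1" "\<gamma> 0 = on_edge (hd us) v s"
    "{last us, v'} \<in> E" "0 < s'" "s' \<le> 1" "\<gamma> L = on_edge (last us) v' s'"
    "\<gamma> ` {0..L} = on_edge (hd us) v ` {0..s} \<union> (\<Union>e\<in>walk_edges us. edge_points e) \<union>
      on_edge (last us) v' ` {0..s'}"
proof -
  obtain s u0 where s: "0 < s" "s \<le> 1" "\<gamma> s = vertex_point u0"
    using isometric_path_first_vertex[OF \<gamma>] L by auto
  define U where "U i = (SOME u. \<gamma> (s + real i) = vertex_point u)" for i :: nat
  have "\<exists>u. \<gamma> (s + real i) = vertex_point u" if "s + real i \<le> L" for i
    using that
  proof (induction i)
    case 0
    then show ?case using s by auto
  next
    case (Suc i)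
    then obtain u where "\<gamma> (s + real i) = vertex_point u" by auto
    then obtain v where "\<And>t. 0 \<le> t \<Longrightarrow> t \<le> 1 \<Longrightarrow> \<gamma> ((s + real i) + t) = on_edge u v t"
      using isometric_path_from_vertex[OF \<gamma>, of "s + real i" 1 u] Suc.prems s(1) by auto
    from this[of 1] show ?case by (auto simp: algebra_simps)
  qed
  then have U: "\<gamma> (s + real i) = vertex_point (U i)" if "s + real i \<le> L" for i
    unfolding U_def using someI_ex[of "\<lambda>u. \<gamma> (s + real i) = vertex_point u"] that by blast
  \<comment> \<open>The last index whose time \<open>s + n\<close> is strictly before \<open>L\<close>.\<close>
  define n where "n = nat (\<lceil>L - s\<rceil> - 1)"
  have "real n = of_int (\<lceil>L - s\<rceil> - 1)" using s L by (simp add: n_def)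
  then have n: "s + real n < L" "L \<le> s + real n + 1" by linarith+
  define us where "us = map U [0..<Suc n]"
  have us: "us \<noteq> []" "length us = Suc n" "hd us = U 0" "last us = U n"
    by (simp_all add: us_def hd_map last_map del: upt_Suc)
  have nth: "us ! i = U i" if "i \<le> n" for i using that by (simp add: us_def del: upt_Suc)
  have edge: "{U i, U (Suc i)} \<in> E \<and> (\<forall>t. 0 \<le> t \<longrightarrow> t \<le> 1 \<longrightarrow> \<gamma> (s + real i + t) = on_edge (U i) (U (Suc i)) t)"
    if i: "i < n" for i
  proof -
    have le: "s + real i + 1 \<le> L" using n i by linarith
    obtain v where v: "{U i, v} \<in> E"
      "\<And>t. 0 \<le> t \<Longrightarrow> t \<le> 1 \<Longrightarrow> \<gamma> ((s + real i) + t) = on_edge (U i) v t"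
      using isometric_path_from_vertex[OF \<gamma>, of "s + real i" 1 "U i"] U[of i] le s(1) by auto
    have "v = U (Suc i)" using v(2)[of 1] U[of "Suc i"] le by (simp add: algebra_simps)
    then show ?thesis using v by blast
  qed
  obtain v where v: "{U 0, v} \<in> E" "\<And>t. 0 \<le> t \<Longrightarrow> t \<le> s \<Longrightarrow> \<gamma> (s - t) = on_edge (U 0) v t"
    using isometric_path_to_vertex[OF \<gamma>, of s s "U 0"] U[of 0] s L by auto
  define s' where "s' = L - (s + real n)"
  have s': "0 < s'" "s' \<le> 1" using n by (auto simp: s'_def)
  obtain v' where v': "{U n, v'} \<in> E" "\<And>t. 0 \<le> t \<Longrightarrow> t \<le> s' \<Longrightarrow> \<gamma> ((s + real n) + t) = on_edge (U n) v' t"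
    using isometric_path_from_vertex[OF \<gamma>, of "s + real n" s' "U n"] U[of n] s s' n by (auto simp: s'_def)
  have "walk_edges us = (\<lambda>i. {us ! i, us ! Suc i}) ` {..<n}"
    using us(2) by (auto simp: walk_edges_def)
  also have "\<dots> = (\<lambda>i. {U i, U (Suc i)}) ` {..<n}"
    by (rule image_cong) (simp_all add: nth)
  finally have edges_us: "walk_edges us = (\<lambda>i. {U i, U (Suc i)}) ` {..<n}" .
  show ?thesis
  proof (rule that[of us v s v' s'])
    show "us \<noteq> []" by (rule us)
    have "U i \<in> V" if "i \<le> n" for i
      using isometric_path_mem[OF \<gamma>, of "s + real i"] U[of i] that n s by simp
    then show "walk V E us"
      using us(1) edge edges_us by (auto simp: walk_iff_edges us_def simp del: upt_Suc)
    show "distinct us"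
    proof -
      have "i = j" if "i \<le> n" "j \<le> n" "U i = U j" for i j
      proof -
        have b: "0 \<le> s + real i" "s + real i \<le> L" "0 \<le> s + real j" "s + real j \<le> L" using that n s by auto
        have "\<gamma> (s + real i) = \<gamma> (s + real j)" using U b that(3) by simp
        then have "\<bar>(s + real i) - (s + real j)\<bar> = 0"
          using isometric_path_dist[OF \<gamma> b] dist_refl[OF isometric_path_mem[OF \<gamma> b(3,4)]] by simp
        then show ?thesis by simp
      qed
      then have "inj_on U {0..<Suc n}" by (auto simp: inj_on_def less_Suc_eq_le)
      then show ?thesis by (simp add: us_def distinct_map del: upt_Suc)
    qed
    show "L \<le> real (length us) + 1" using n s us(2) by simp
    show "\<exists>t. 0 < t \<and> t < L \<and> \<gamma> t = vertex_point u" if u: "u \<in> set us" for u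
    proof -
      obtain i where "i \<le> n" "u = U i" using u by (auto simp: us_def less_Suc_eq_le simp del: upt_Suc)
      then show ?thesis using U[of i] n s by (intro exI[of _ "s + real i"]) auto
    qed
    show "{hd us, v} \<in> E" "{last us, v'} \<in> E" using v v' us by auto
    show "0 < s" "s \<le> 1" "0 < s'" "s' \<le> 1" using s s' by auto
    show "\<gamma> 0 = on_edge (hd us) v s" "\<gamma> L = on_edge (last us) v' s'"
      using v(2)[of s] v'(2)[of s'] s s' us by (auto simp: s'_def)
    have start: "\<gamma> ` {0..s} = on_edge (U 0) v ` {0..s}"
    proof -
      have "{0..s} = (\<lambda>t. s - t) ` {0..s}" by simp
      then have "\<gamma> ` {0..s} = (\<lambda>t. \<gamma> (s - t)) ` {0..s}" by (metis image_image)
      then show ?thesis using v(2) by simp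
    qed
    have final: "\<gamma> ` {s + real n..L} = on_edge (U n) v' ` {0..s'}"
    proof -
      have "{s + real n..L} = (\<lambda>t. (s + real n) + t) ` {0..s'}" by (simp add: s'_def)
      then have "\<gamma> ` {s + real n..L} = (\<lambda>t. \<gamma> ((s + real n) + t)) ` {0..s'}" by (metis image_image)
      then show ?thesis using v'(2) by simp
    qed
    have unit: "\<gamma> ` {s + real i..s + real i + 1} = edge_points {U i, U (Suc i)}" if "i < n" for i
    proof -
      have "{s + real i..s + real i + 1} = (\<lambda>t. (s + real i) + t) ` {0..1}" by simp
      then have "\<gamma> ` {s + real i..s + real i + 1} = (\<lambda>t. \<gamma> ((s + real i) + t)) ` {0..1}" by (metis image_image)
      then show ?thesis using edge[OF that] edge_points_image[of "U i" "U (Suc i)"] edge_neq by simp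
    qed
    have "{s..s + real k} \<subseteq> {s} \<union> (\<Union>i<k. {s + real i..s + real i + 1})" for k
    proof (induction k)
      case (Suc k)
      have "{s..s + real (Suc k)} \<subseteq> {s..s + real k} \<union> {s + real k..s + real k + 1}" by auto
      also have "\<dots> \<subseteq> {s} \<union> (\<Union>i<Suc k. {s + real i..s + real i + 1})"
        using Suc by (auto simp: lessThan_Suc)
      finally show ?case .
    qed simp
    then have "{0..L} = {0..s} \<union> (\<Union>i<n. {s + real i..s + real i + 1}) \<union> {s + real n..L}"
    proof -
      assume cover: "\<And>k. {s..s + real k} \<subseteq> {s} \<union> (\<Union>i<k. {s + real i..s + real i + 1})"
      have "{0..L} \<subseteq> {0..s} \<union> {s..s + real n} \<union> {s + real n..L}" by auto
      then have "{0..L} \<subseteq> {0..s} \<union> (\<Union>i<n. {s + real i..s + real i + 1}) \<union> {s + real n..L}"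
        using cover[of n] s(1) by fastforce
      moreover have "{s + real i..s + real i + 1} \<subseteq> {0..L}" if "i < n" for i
      proof -
        have "real i + 1 \<le> real n" using that by linarith
        then show ?thesis using n s by auto
      qed
      ultimately show ?thesis using n s by (auto 0 3)
    qed
    then have "\<gamma> ` {0..L} = \<gamma> ` {0..s} \<union> (\<Union>i<n. \<gamma> ` {s + real i..s + real i + 1}) \<union> \<gamma> ` {s + real n..L}"
      by (simp only: image_Un image_UN)
    also have "(\<Union>i<n. \<gamma> ` {s + real i..s + real i + 1}) = (\<Union>e\<in>walk_edges us. edge_points e)"
      unfolding edges_us using unit by auto
    finally show "\<gamma> ` {0..L} = on_edge (hd us) v ` {0..s} \<union> (\<Union>e\<in>walk_edges us. edge_points e) \<union>
      on_edge (last us) v' ` {0..s'}"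
      using start final us by simp
  qed
qed

end

section \<open>The cycle formed by two geodesics\<close>

context connected_graph
begin

text \<open>Two geodesics issue from a point \<open>x\<close> towards different first vertices \<open>u\<close> and \<open>w\<close>. Either \<open>x\<close> is a
  vertex adjacent to both, or \<open>x\<close> is inside an edge and \<open>u\<close> and \<open>w\<close> are its ends. Accordingly \<open>cs\<close>
  consists of \<open>x\<close> or is empty, and in both cases the edges of the walk cover exactly the two
  initial pieces.\<close>

lemma connecting_walk:
  assumes "{u, v} \<in> E" "0 < s" "s \<le> 1" "{w, z} \<in> E" "0 < r" "r \<le> 1" "u \<noteq> w"
    and eq: "on_edge u v s = on_edge w z r"
  obtains cs where "distinct cs" "\<And>c. c \<in> set cs \<Longrightarrow> c \<in> V \<and> on_edge u v s = vertex_point c"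
    "walk_edges (w # cs @ [u]) \<subseteq> E"
    "(\<Union>e\<in>walk_edges (w # cs @ [u]). edge_points e) = on_edge u v ` {0..s} \<union> on_edge w z ` {0..r}"
proof -
  have uv: "u \<noteq> v" and wz: "w \<noteq> z" using assms edge_neq by auto
  have coord: "on_edge u v s x = on_edge w z r x" for x using eq by simp
  show ?thesis
  proof (cases "s = 1")
    case True
    have "v = w \<or> v = z" using coord[of v] on_edge_other[of v w z r] True by (auto simp: vertex_point_apply)
    moreover have "v \<noteq> w" using coord[of w] wz True assms(5) by (auto simp: vertex_point_apply)
    ultimately have v: "v = z" by simp
    then have r: "r = 1" using coord[of v] wz True by (simp add: vertex_point_apply)
    show ?thesis
    proof (rule that[of "[v]"])
      show "walk_edges (w # [v] @ [u]) \<subseteq> E" using assms(1,4) v by (simp add: insert_commute)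
      show "(\<Union>e\<in>walk_edges (w # [v] @ [u]). edge_points e) = on_edge u v ` {0..s} \<union> on_edge w z ` {0..r}"
        using edge_points_image[OF uv] edge_points_image[OF wz] True r v
        by (auto simp: insert_commute)
    qed (use True assms(1) edge_verts in auto)
  next
    case False
    then have s: "0 < s" "s < 1" using assms by auto
    have "on_edge w z r u > 0" using coord[of u] uv s by simp
    then have z: "u = z" using on_edge_other[of u w z r] assms(7) by fastforce
    then have r: "r = 1 - s" using coord[of u] uv wz by simp
    then have "on_edge u v s w > 0" using coord[of w] wz s by simp
    then have w: "w = v" using on_edge_other[of w u v s] assms(7) by fastforce
    show ?thesis
    proof (rule that[of "[]"])
      show "walk_edges (w # [] @ [u]) \<subseteq> E" using assms(4) z by simp
      have "on_edge w z ` {0..r} = on_edge u v ` {s..1}"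
      proof -
        have "{s..1} = (\<lambda>t. 1 - t) ` {0..r}" by (simp add: r)
        then have "on_edge u v ` {s..1} = (\<lambda>t. on_edge u v (1 - t)) ` {0..r}" by (metis image_image)
        also have "\<dots> = on_edge w z ` {0..r}" using on_edge_commute[of v u] z w by simp
        finally show ?thesis by simp
      qed
      moreover have "{0..1} = {0..s} \<union> {s..1}" using s by auto
      ultimately have "edge_points {u, v} = on_edge u v ` {0..s} \<union> on_edge w z ` {0..r}"
        using edge_points_image[OF uv] by (simp add: image_Un)
      then show "(\<Union>e\<in>walk_edges (w # [] @ [u]). edge_points e) = on_edge u v ` {0..s} \<union> on_edge w z ` {0..r}"
        using w by (simp add: insert_commute)
    qed auto
  qed
qed

text \<open>The cycle lists the inner vertices of \<open>\<alpha>\<close>, then the end if it is a vertex, the inner vertices of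
  \<open>\<beta>\<close> backwards, and the start if it is a vertex. Vertices do not repeat: a vertex on both geodesics has
  the same parameter on both, namely its distance from the start.\<close>

lemma bigon_cycle_exists:
  assumes \<alpha>: "isometric_path X d \<alpha> L" and \<beta>: "isometric_path X d \<beta> L" and L: "3 \<le> L"
    and start: "\<alpha> 0 = \<beta> 0" and final: "\<alpha> L = \<beta> L"
    and inner: "\<And>s. 0 < s \<Longrightarrow> s < L \<Longrightarrow> \<alpha> s \<noteq> \<beta> s"
  shows "\<exists>C. bigon_cycle V E C \<alpha> \<beta> L \<and> 2 * L - 2 \<le> real (walk_length C)"
proof -
  have L1: "1 < L" using L by simp
  obtain us v v' s s' where us: "us \<noteq> []" "walk V E us" "distinct us" "L \<le> real (length us) + 1"
    "\<And>u. u \<in> set us \<Longrightarrow> \<exists>t. 0 < t \<and> t < L \<and> \<alpha> t = vertex_point u"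
    and us_start: "{hd us, v} \<in> E" "0 < s" "s \<le> 1" "\<alpha> 0 = on_edge (hd us) v s"
    and us_end: "{last us, v'} \<in> E" "0 < s'" "s' \<le> 1" "\<alpha> L = on_edge (last us) v' s'"
    and us_image: "\<alpha> ` {0..L} = on_edge (hd us) v ` {0..s} \<union> (\<Union>e\<in>walk_edges us. edge_points e) \<union>
      on_edge (last us) v' ` {0..s'}"
    by (rule isometric_path_vertices[OF \<alpha> L1]) (rule that)
  obtain ws z z' r r' where ws: "ws \<noteq> []" "walk V E ws" "distinct ws" "L \<le> real (length ws) + 1"
    "\<And>u. u \<in> set ws \<Longrightarrow> \<exists>t. 0 < t \<and> t < L \<and> \<beta> t = vertex_point u"
    and ws_start: "{hd ws, z} \<in> E" "0 < r" "r \<le> 1" "\<beta> 0 = on_edge (hd ws) z r"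
    and ws_end: "{last ws, z'} \<in> E" "0 < r'" "r' \<le> 1" "\<beta> L = on_edge (last ws) z' r'"
    and ws_image: "\<beta> ` {0..L} = on_edge (hd ws) z ` {0..r} \<union> (\<Union>e\<in>walk_edges ws. edge_points e) \<union>
      on_edge (last ws) z' ` {0..r'}"
    by (rule isometric_path_vertices[OF \<beta> L1]) (rule that)
  have ends_X: "\<alpha> 0 \<in> X" "\<alpha> L \<in> X" using isometric_path_mem[OF \<alpha>] L by auto
  have dist_\<alpha>: "d (\<alpha> 0) (\<alpha> t) = t" and dist_\<beta>: "d (\<alpha> 0) (\<beta> t) = t" if "0 \<le> t" "t \<le> L" for t
    using isometric_path_dist[OF \<alpha>, of 0 t] isometric_path_dist[OF \<beta>, of 0 t] that start by auto
  have disjoint: "set us \<inter> set ws = {}"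
  proof (rule ccontr)
    assume "\<not> ?thesis"
    then obtain u where u: "u \<in> set us" "u \<in> set ws" by blast
    obtain t t' where "0 < t" "t < L" "\<alpha> t = vertex_point u" "0 < t'" "t' < L" "\<beta> t' = vertex_point u"
      using us(5)[OF u(1)] ws(5)[OF u(2)] by blast
    then show False using dist_\<alpha>[of t] dist_\<beta>[of t'] inner[of t] by simp
  qed
  have no_end: "vertex_point u \<noteq> \<alpha> 0" "vertex_point u \<noteq> \<alpha> L" if u: "u \<in> set us \<or> u \<in> set ws" for u
  proof -
    obtain t where "0 < t" "t < L" "d (\<alpha> 0) (vertex_point u) = t"
      using us(5)[of u] ws(5)[of u] u dist_\<alpha> dist_\<beta> by (metis less_imp_le)
    then show "vertex_point u \<noteq> \<alpha> 0" "vertex_point u \<noteq> \<alpha> L" using dist_\<alpha>[of 0] dist_\<alpha>[of L] L by auto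
  qed
  have "hd us \<noteq> hd ws" "last us \<noteq> last ws" using disjoint us(1) ws(1) by (metis IntI empty_iff hd_in_set, metis IntI empty_iff last_in_set)
  obtain cs where cs: "distinct cs" "\<And>c. c \<in> set cs \<Longrightarrow> c \<in> V \<and> \<alpha> 0 = vertex_point c"
    "walk_edges (hd ws # cs @ [hd us]) \<subseteq> E"
    "(\<Union>e\<in>walk_edges (hd ws # cs @ [hd us]). edge_points e) = on_edge (hd us) v ` {0..s} \<union> on_edge (hd ws) z ` {0..r}"
    using connecting_walk[OF us_start(1-3) ws_start(1-3) \<open>hd us \<noteq> hd ws\<close>] us_start(4) ws_start(4) start
    by metis
  obtain ds where ds: "distinct ds" "\<And>c. c \<in> set ds \<Longrightarrow> c \<in> V \<and> \<alpha> L = vertex_point c"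
    "walk_edges (last us # ds @ [last ws]) \<subseteq> E"
    "(\<Union>e\<in>walk_edges (last us # ds @ [last ws]). edge_points e) = on_edge (last ws) z' ` {0..r'} \<union> on_edge (last us) v' ` {0..s'}"
    using connecting_walk[OF ws_end(1-3) us_end(1-3) \<open>last us \<noteq> last ws\<close>[symmetric]] us_end(4) ws_end(4) final
    by metis
  define C where "C = us @ ds @ rev ws @ cs @ [hd us]"
  obtain ts where ts: "rev ws = last ws # ts"
    using ws(1) by (metis hd_rev list.exhaust_sel rev_is_Nil_conv)
  have "walk_edges C = walk_edges us \<union> walk_edges ((last us # ds) @ last ws # (ts @ cs @ [hd us]))"
    unfolding C_def ts using walk_edges_append[OF us(1), of "ds @ last ws # ts @ cs @ [hd us]"] by simp
  also have "walk_edges ((last us # ds) @ last ws # (ts @ cs @ [hd us])) =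
      walk_edges (last us # ds @ [last ws]) \<union> walk_edges (rev ws @ cs @ [hd us])"
    unfolding ts using walk_edges_join[of "last us # ds" "last ws" "ts @ cs @ [hd us]"] by simp
  also have "walk_edges (rev ws @ cs @ [hd us]) = walk_edges ws \<union> walk_edges (hd ws # cs @ [hd us])"
    using walk_edges_append[of "rev ws" "cs @ [hd us]"] ws(1) by (simp add: last_rev)
  finally have edges_C: "walk_edges C = walk_edges us \<union> (walk_edges (last us # ds @ [last ws]) \<union>
    (walk_edges ws \<union> walk_edges (hd ws # cs @ [hd us])))" .
  have walk: "walk V E C"
    using us(1,2) ws(1,2) cs(2,3) ds(2,3) edges_C hd_in_set[OF us(1)]
    unfolding walk_iff_edges by (auto simp: C_def)
  have "distinct (us @ ds @ rev ws @ cs)"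
  proof -
    have "set ds \<inter> set us = {}" "set ds \<inter> set ws = {}" "set cs \<inter> set us = {}" "set cs \<inter> set ws = {}"
      using no_end cs(2) ds(2) by fastforce+
    moreover have "\<alpha> 0 \<noteq> \<alpha> L" using dist_\<alpha>[of L] ends_X L by auto
    then have "set ds \<inter> set cs = {}" using cs(2) ds(2) by fastforce
    ultimately show ?thesis using us(3) ws(3) cs(1) ds(1) disjoint by auto
  qed
  then have distinct: "distinct (tl C)" using us(1) by (cases us) (auto simp: C_def)
  have len: "2 * L - 2 \<le> real (walk_length C)" "4 \<le> length C"
  proof -
    have "length C \<ge> length us + length ws + 1" by (simp add: C_def)
    then have "real (length us) + real (length ws) + 1 \<le> real (length C)" by linarith
    then show "2 * L - 2 \<le> real (walk_length C)" "4 \<le> length C"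
      using us(4) ws(4) L by (simp_all add: walk_length_def)
  qed
  have cycle: "vertex_cycle V E C"
    using walk distinct len(2) us(1) by (auto simp: vertex_cycle_def C_def)
  interpret graph_cycle V E C by unfold_locales (rule cycle)
  have "trace C = (\<Union>e\<in>walk_edges C. edge_points e)"
  proof -
    have "vertex_point a \<in> (\<Union>e\<in>walk_edges C. edge_points e)" if a: "a \<in> set C" for a
    proof -
      obtain i where i: "i < length C" "C ! i = a" using a by (metis in_set_conv_nth)
      define j where "j = (if i = 0 then 0 else i - 1)"
      have j: "Suc j < length C" "a \<in> {C ! j, C ! Suc j}" using i len(2) by (auto simp: j_def)
      then have e: "{C ! j, C ! Suc j} \<in> walk_edges C" unfolding walk_edges_def by blast
      show ?thesis using e vertex_point_mem_edge[OF cyc.edge_card[OF e] j(2)] by blast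
    qed
    then show ?thesis by (auto simp: trace_def graph_points_def)
  qed
  also have "\<dots> = \<alpha> ` {0..L} \<union> \<beta> ` {0..L}"
    unfolding edges_C UN_Un cs(4) ds(4) us_image ws_image by blast
  finally have "bigon_cycle V E C \<alpha> \<beta> L"
    using \<alpha> \<beta> start final by unfold_locales
  then show ?thesis using len(1) by blast
qed

end

section \<open>Hausdorff distance and bigons as sets\<close>

context connected_graph
begin

lemma hausdorff_dist_le:
  assumes AB: "A \<subseteq> X" "B \<subseteq> X" "A \<noteq> {}" "B \<noteq> {}"
    and near: "\<And>a. a \<in> A \<Longrightarrow> \<exists>b\<in>B. d a b \<le> R" "\<And>b. b \<in> B \<Longrightarrow> \<exists>a\<in>A. d a b \<le> R"
  shows "hausdorff_dist d A B \<le> R"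
proof -
  have "(INF b\<in>B. d a b) \<le> R" if "a \<in> A" for a
  proof -
    obtain b where "b \<in> B" "d a b \<le> R" using near(1) \<open>a \<in> A\<close> by blast
    then show ?thesis using AB dist_nonneg \<open>a \<in> A\<close>
      by (intro cINF_lower2[of _ _ b]) (auto intro!: bdd_belowI[of _ 0])
  qed
  moreover have "(INF a\<in>A. d a b) \<le> R" if "b \<in> B" for b
  proof -
    obtain a where "a \<in> A" "d a b \<le> R" using near(2) \<open>b \<in> B\<close> by blast
    then show ?thesis using AB dist_nonneg \<open>b \<in> B\<close>
      by (intro cINF_lower2[of _ _ a]) (auto intro!: bdd_belowI[of _ 0])
  qed
  ultimately show ?thesis unfolding hausdorff_dist_def using AB(3,4)
    by (auto intro!: cSUP_least)
qed

text \<open>A supremum of reals bounds its members only if they are bounded; the common point and the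
  bound by \<open>L\<close> guarantee this for the suprema in the definition.\<close>

lemma hausdorff_dist_close:
  assumes le: "hausdorff_dist d A B \<le> R" and AB: "A \<subseteq> X" "B \<subseteq> X"
    and x: "x \<in> A" "x \<in> B" and bounded: "\<And>p. p \<in> A \<union> B \<Longrightarrow> d x p \<le> L"
  shows "a \<in> A \<Longrightarrow> \<exists>b\<in>B. d a b < R + 1" and "b \<in> B \<Longrightarrow> \<exists>a\<in>A. d b a < R + 1"
proof -
  have bb: "bdd_below ((\<lambda>b. d a b) ` B)" if "a \<in> X" for a
    using AB dist_nonneg that by (auto intro!: bdd_belowI[of _ 0])
  have ba: "bdd_below ((\<lambda>a. d a b) ` A)" if "b \<in> X" for b
    using AB dist_nonneg that by (auto intro!: bdd_belowI[of _ 0])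
  have "(INF b\<in>B. d a b) \<le> L" if "a \<in> A" for a
    using cINF_lower[OF bb, of a x] bounded[of a] that AB x dist_commute[of a x] by fastforce
  then have bda: "bdd_above ((\<lambda>a. INF b\<in>B. d a b) ` A)" by (auto intro!: bdd_aboveI[of _ L])
  have "(INF a\<in>A. d a b) \<le> L" if "b \<in> B" for b
    using cINF_lower[OF ba, of b x] bounded[of b] that AB x by fastforce
  then have bdb: "bdd_above ((\<lambda>b. INF a\<in>A. d a b) ` B)" by (auto intro!: bdd_aboveI[of _ L])
  show "\<exists>b\<in>B. d a b < R + 1" if "a \<in> A"
  proof -
    have "(INF b\<in>B. d a b) \<le> (SUP a\<in>A. INF b\<in>B. d a b)" using cSUP_upper[OF that bda] .
    also have "\<dots> < R + 1" using le by (simp add: hausdorff_dist_def)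
    finally show ?thesis using cInf_lessD[of "(\<lambda>b. d a b) ` B" "R + 1"] x by auto
  qed
  show "\<exists>a\<in>A. d b a < R + 1" if "b \<in> B"
  proof -
    have "(INF a\<in>A. d a b) \<le> (SUP b\<in>B. INF a\<in>A. d a b)" using cSUP_upper[OF that bdb] .
    also have "\<dots> < R + 1" using le by (simp add: hausdorff_dist_def)
    finally show ?thesis using cInf_lessD[of "(\<lambda>a. d a b) ` A" "R + 1"] x dist_commute[of b] by auto
  qed
qed

lemma geodesic_iff_isometric_path:
  assumes "x \<in> X" "y \<in> X"
  shows "geodesic X d x y S \<longleftrightarrow>
    (\<exists>\<gamma>. isometric_path X d \<gamma> (d x y) \<and> \<gamma> 0 = x \<and> \<gamma> (d x y) = y \<and> \<gamma> ` {0..d x y} = S)"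
  using dist_nonneg[OF assms] unfolding geodesic_def isometric_path_def by blast

lemma bigon_cycles_imp_bigon_cycle:
  assumes "C \<in> bigon_cycles V E"
  obtains \<alpha> \<beta> L where "bigon_cycle V E C \<alpha> \<beta> L"
proof -
  obtain x y S T where C: "vertex_cycle V E C" and xy: "x \<in> X" "y \<in> X"
    and ST: "geodesic X d x y S" "geodesic X d x y T" "trace C = S \<union> T"
    using assms unfolding bigon_cycles_def bigon_def by auto
  obtain \<alpha> where "isometric_path X d \<alpha> (d x y)" "\<alpha> 0 = x" "\<alpha> (d x y) = y" "\<alpha> ` {0..d x y} = S"
    using ST(1) unfolding geodesic_iff_isometric_path[OF xy] by (elim exE conjE)
  moreover obtain \<beta> where "isometric_path X d \<beta> (d x y)" "\<beta> 0 = x" "\<beta> (d x y) = y" "\<beta> ` {0..d x y} = T"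
    using ST(2) unfolding geodesic_iff_isometric_path[OF xy] by (elim exE conjE)
  ultimately have "bigon_cycle V E C \<alpha> \<beta> (d x y)" using C ST(3) by unfold_locales auto
  then show ?thesis using that by blast
qed

end

context bigon_cycle
begin

lemma in_bigon_cycles: "C \<in> bigon_cycles V E"
proof -
  have L: "d (\<alpha> 0) (\<alpha> L) = L" using dist_start(1)[of L] length_nonneg by simp
  have "geodesic X d (\<alpha> 0) (\<alpha> L) (\<alpha> ` {0..L})" "geodesic X d (\<alpha> 0) (\<alpha> L) (\<beta> ` {0..L})"
    using geodesic_iff_isometric_path[OF start_in end_in] L \<alpha> \<beta> start_eq end_eq by metis+
  then show ?thesis using cycle trace_eq start_in end_in by (auto simp: bigon_cycles_def bigon_def)
qed

end

section \<open>Shortcuts yield stability\<close>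

context bigon_cycle
begin

text \<open>A shortcut cannot join two vertices on the same side, since the side is geodesic.\<close>

lemma close_of_dense_shortcuts:
  assumes sc: "\<And>\<sigma>. \<sigma> \<in> \<Sigma> \<Longrightarrow> strict_shortcut V E C \<sigma> \<and> walk_length \<sigma> \<le> m"
    and dense: "dense_subset \<epsilon> (trace C) (cycle_dist C) (\<Union>\<sigma>\<in>\<Sigma>. shortcut_vertices \<sigma>)"
    and s: "0 \<le> s" "s \<le> L"
  shows "\<exists>t. 0 \<le> t \<and> t \<le> L \<and> d (\<alpha> s) (\<beta> t) \<le> \<epsilon> + real m"
proof -
  have p: "\<alpha> s \<in> trace C" using trace_eq s by auto
  obtain \<sigma> q where \<sigma>: "\<sigma> \<in> \<Sigma>" "q \<in> shortcut_vertices \<sigma>" "cycle_dist C q (\<alpha> s) < \<epsilon>"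
    using dense p unfolding dense_subset_def by blast
  have sh: "vertex_path V E \<sigma>" "hd \<sigma> \<in> set C" "last \<sigma> \<in> set C" "walk_length \<sigma> \<le> m"
    "real (walk_length \<sigma>) < cycle_dist C (vertex_point (hd \<sigma>)) (vertex_point (last \<sigma>))"
    using sc[OF \<sigma>(1)] by (auto simp: strict_shortcut_def shortcut_def)
  define h where "h = vertex_point (hd \<sigma>)"
  define l where "l = vertex_point (last \<sigma>)"
  have hl: "h \<in> trace C" "l \<in> trace C" using sh vertex_point_in_trace by (auto simp: h_def l_def)
  have len: "d h l \<le> real (walk_length \<sigma>)"
    using dist_le_linked[OF linked_walk] sh(1) by (auto simp: vertex_path_def h_def l_def)
  have qhl: "q = h \<or> q = l" using \<sigma>(2) by (auto simp: shortcut_vertices_def h_def l_def)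
  have "\<not> (h \<in> \<alpha> ` {0..L} \<and> l \<in> \<alpha> ` {0..L})"
  proof
    assume "h \<in> \<alpha> ` {0..L} \<and> l \<in> \<alpha> ` {0..L}"
    then obtain a b where ab: "0 \<le> a" "a \<le> L" "h = \<alpha> a" "0 \<le> b" "b \<le> L" "l = \<alpha> b" by auto
    have "cycle_dist C (\<alpha> a) (\<alpha> b) \<le> \<bar>a - b\<bar>"
      using trace_eq by (intro cycle_dist_isometric_path[OF \<alpha> _ ab(1,2,4,5)]) auto
    also have "\<dots> = d h l" using isometric_path_dist[OF \<alpha> ab(1,2,4,5)] ab by simp
    finally show False using len sh(5) ab by (simp add: h_def l_def)
  qed
  then obtain r where r: "r \<in> \<beta> ` {0..L}" "r = h \<or> r = l" using hl trace_eq by auto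
  have pX: "\<alpha> s \<in> X" "q \<in> X" "r \<in> X" using p qhl r(2) hl trace_subset by auto
  have "d q r \<le> real m"
  proof -
    have "d q r = 0 \<or> d q r = d h l" using qhl r(2) dist_refl pX dist_commute[of h l] by auto
    then show ?thesis using len sh(4) by auto
  qed
  moreover have "d (\<alpha> s) q < \<epsilon>"
    using dist_le_cycle_dist[of q "\<alpha> s"] \<sigma>(3) qhl hl p dist_commute[of q] by auto
  ultimately have "d (\<alpha> s) r \<le> \<epsilon> + real m" using dist_triangle[OF pX] by linarith
  then show ?thesis using r(1) by auto
qed

end

context connected_graph
begin

text \<open>Let \<open>(a, b)\<close> be the maximal interval around \<open>s\<close> on which the geodesics differ. Unless it is
  short, the pieces over \<open>[a, b]\<close> form a bigon cycle with at least \<open>2 * (b - a) - 2 \<ge> k\<close> edges, to which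
  dense chordality applies.\<close>

lemma geodesics_close:
  assumes \<epsilon>: "0 < \<epsilon>" and dense: "densely_chordal_on V E \<epsilon> k m (bigon_cycles V E)"
    and \<alpha>: "isometric_path X d \<alpha> L" and \<beta>: "isometric_path X d \<beta> L"
    and start: "\<alpha> 0 = \<beta> 0" and final: "\<alpha> L = \<beta> L" and s: "0 \<le> s" "s \<le> L"
  shows "\<exists>t. 0 \<le> t \<and> t \<le> L \<and> d (\<alpha> s) (\<beta> t) \<le> real k + 3 + \<epsilon> + real m"
proof -
  have \<alpha>X: "\<alpha> t \<in> X" and \<beta>X: "\<beta> t \<in> X" if "0 \<le> t" "t \<le> L" for t
    using isometric_path_mem[OF \<alpha> that] isometric_path_mem[OF \<beta> that] by auto
  define h where "h t = d (\<alpha> t) (\<beta> t)" for t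
  have h0: "h t = 0 \<longleftrightarrow> \<alpha> t = \<beta> t" if "0 \<le> t" "t \<le> L" for t
    unfolding h_def using dist_eq_0_iff[OF \<alpha>X[OF that] \<beta>X[OF that]] .
  have cont: "continuous_on {0..L} h"
  proof (rule lipschitz_imp_continuous_on[of _ _ 2])
    fix t t' assume "t \<in> {0..L}" "t' \<in> {0..L}"
    then have t: "0 \<le> t" "t \<le> L" "0 \<le> t'" "t' \<le> L" by auto
    show "\<bar>h t - h t'\<bar> \<le> 2 * \<bar>t - t'\<bar>"
      using dist_triangle[OF \<alpha>X[OF t(1,2)] \<alpha>X[OF t(3,4)] \<beta>X[OF t(1,2)]]
        dist_triangle[OF \<alpha>X[OF t(3,4)] \<beta>X[OF t(3,4)] \<beta>X[OF t(1,2)]]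
        dist_triangle[OF \<alpha>X[OF t(3,4)] \<alpha>X[OF t(1,2)] \<beta>X[OF t(3,4)]]
        dist_triangle[OF \<alpha>X[OF t(1,2)] \<beta>X[OF t(1,2)] \<beta>X[OF t(3,4)]]
        isometric_path_dist[OF \<alpha> t] isometric_path_dist[OF \<alpha> t(3,4,1,2)]
        isometric_path_dist[OF \<beta> t] isometric_path_dist[OF \<beta> t(3,4,1,2)]
      unfolding h_def by (smt (verit))
  qed simp
  have L: "0 \<le> L" using s by simp
  obtain a where a: "0 \<le> a" "a \<le> s" "h a = 0" "\<And>t. a < t \<Longrightarrow> t \<le> s \<Longrightarrow> h t \<noteq> 0"
    using last_zero[of 0 s h] continuous_on_subset[OF cont, of "{0..s}"] s h0[of 0] L start by auto
  obtain b where b: "s \<le> b" "b \<le> L" "h b = 0" "\<And>t. s \<le> t \<Longrightarrow> t < b \<Longrightarrow> h t \<noteq> 0"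
    using first_zero[of s L h] continuous_on_subset[OF cont, of "{s..L}"] s h0[of L] L final by auto
  have ab: "\<alpha> a = \<beta> a" "\<alpha> b = \<beta> b" using a b h0 s by auto
  show ?thesis
  proof (cases "b - a < real k + 3")
    case True
    have "d (\<alpha> s) (\<beta> a) = s - a" using isometric_path_dist[OF \<alpha>, of s a] a s ab(1) by simp
    then have "d (\<alpha> s) (\<beta> a) \<le> real k + 3 + \<epsilon> + real m" using True b(1) \<epsilon> by simp
    then show ?thesis using a s by (intro exI[of _ a]) simp
  next
    case False
    have inner: "\<alpha> (a + t) \<noteq> \<beta> (a + t)" if "0 < t" "t < b - a" for t
      using a(4)[of "a + t"] b(4)[of "a + t"] h0[of "a + t"] that a b by (cases "a + t \<le> s") auto
    have "a \<le> b" using a b by simp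
    obtain C where C: "bigon_cycle V E C (\<lambda>t. \<alpha> (a + t)) (\<lambda>t. \<beta> (a + t)) (b - a)"
      "2 * (b - a) - 2 \<le> real (walk_length C)"
      using bigon_cycle_exists[OF isometric_path_shift[OF \<alpha> a(1) \<open>a \<le> b\<close> b(2)]
          isometric_path_shift[OF \<beta> a(1) \<open>a \<le> b\<close> b(2)]] False ab inner by auto
    interpret bigon_cycle V E C "\<lambda>t. \<alpha> (a + t)" "\<lambda>t. \<beta> (a + t)" "b - a" by (rule C)
    have "real k \<le> real (walk_length C)" 
    proof -
      have "0 \<le> real k" by simp
      then show ?thesis using False C(2) by (smt (verit))
    qed
    then have "k \<le> walk_length C" by simp
    then obtain \<Sigma> where \<Sigma>: "\<And>\<sigma>. \<sigma> \<in> \<Sigma> \<Longrightarrow> strict_shortcut V E C \<sigma> \<and> walk_length \<sigma> \<le> m"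
      "dense_subset \<epsilon> (trace C) (cycle_dist C) (\<Union>\<sigma>\<in>\<Sigma>. shortcut_vertices \<sigma>)"
      using dense in_bigon_cycles unfolding densely_chordal_on_def by meson
    obtain t where "0 \<le> t" "t \<le> b - a" "d (\<alpha> (a + (s - a))) (\<beta> (a + t)) \<le> \<epsilon> + real m"
      using close_of_dense_shortcuts[OF \<Sigma>, of "s - a"] a b by auto
    then show ?thesis using a b by (intro exI[of _ "a + t"]) auto
  qed
qed

lemma stable_if_densely_chordal:
  assumes \<epsilon>: "0 < \<epsilon>" and dense: "densely_chordal_on V E \<epsilon> k m (bigon_cycles V E)"
  shows "stable_geodesics X d"
  unfolding stable_geodesics_def
proof (intro exI[of _ "real k + 3 + \<epsilon> + real m"] conjI ballI allI impI)
  fix x y S T assume x: "x \<in> X" and y: "y \<in> X" and "geodesic X d x y S \<and> geodesic X d x y T"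
  then obtain \<alpha> \<beta> where g: "isometric_path X d \<alpha> (d x y)" "isometric_path X d \<beta> (d x y)"
    "\<alpha> 0 = \<beta> 0" "\<alpha> (d x y) = \<beta> (d x y)" "S = \<alpha> ` {0..d x y}" "T = \<beta> ` {0..d x y}"
    using geodesic_iff_isometric_path[OF x y] by metis
  show "hausdorff_dist d T S \<le> real k + 3 + \<epsilon> + real m"
  proof (rule hausdorff_dist_le)
    show "T \<subseteq> X" "S \<subseteq> X" using g by (auto simp: isometric_path_def)
    show "T \<noteq> {}" "S \<noteq> {}" using g dist_nonneg[OF x y] by auto
    show "\<exists>b\<in>S. d a b \<le> real k + 3 + \<epsilon> + real m" if "a \<in> T" for a
      using geodesics_close[OF \<epsilon> dense g(2,1)] g(3-6) that by fastforce
    show "\<exists>a\<in>T. d a b \<le> real k + 3 + \<epsilon> + real m" if "b \<in> S" for b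
      using geodesics_close[OF \<epsilon> dense g(1-4)] g(5,6) that dist_commute[of b] by fastforce
  qed
qed (use \<epsilon> in simp)

lemma densely_chordal_if_stable:
  assumes "stable_geodesics X d"
  shows "\<exists>(\<epsilon>::real) (k::nat) (m::nat). \<epsilon> > 0 \<and> k \<ge> 4 \<and> k \<ge> 2 * m \<and>
      densely_chordal_on V E \<epsilon> k m (bigon_cycles V E)"
proof -
  obtain R where R: "0 \<le> R" "\<And>x y S T. x \<in> X \<Longrightarrow> y \<in> X \<Longrightarrow> geodesic X d x y S \<Longrightarrow> geodesic X d x y T \<Longrightarrow>
      hausdorff_dist d T S \<le> R"
    using assms unfolding stable_geodesics_def by blast
  define m where "m = nat \<lceil>R + 2\<rceil>"
  \<comment> \<open>A cycle with at least \<open>8 * (R + 3) + 2\<close> edges has sides of length \<open>L \<ge> 4 * (R + 3)\<close>, since it has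
    at most \<open>2 * L + 2\<close> edges.\<close>
  define k where "k = 4 + 2 * m + nat \<lceil>8 * (R + 3) + 2\<rceil>"
  have "densely_chordal_on V E (3 * R + 9) k m (bigon_cycles V E)"
    unfolding densely_chordal_on_def
  proof (intro ballI impI)
    fix C assume C: "C \<in> bigon_cycles V E" "k \<le> walk_length C"
    obtain \<alpha> \<beta> L where "bigon_cycle V E C \<alpha> \<beta> L" using bigon_cycles_imp_bigon_cycle[OF C(1)] .
    then interpret bigon_cycle V E C \<alpha> \<beta> L .
    have dL: "d (\<alpha> 0) (\<alpha> L) = L" using dist_start(1)[of L] length_nonneg by simp
    have "geodesic X d (\<alpha> 0) (\<alpha> L) (\<alpha> ` {0..L})" "geodesic X d (\<alpha> 0) (\<alpha> L) (\<beta> ` {0..L})"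
      using geodesic_iff_isometric_path[OF start_in end_in] dL \<alpha> \<beta> start_eq end_eq by metis+
    then have haus: "hausdorff_dist d (\<alpha> ` {0..L}) (\<beta> ` {0..L}) \<le> R" using R(2) start_in end_in by blast
    have start: "\<alpha> 0 \<in> \<alpha> ` {0..L}" using length_nonneg by simp
    have start': "\<alpha> 0 \<in> \<beta> ` {0..L}" unfolding start_eq using length_nonneg by simp
    have bounded: "d (\<alpha> 0) p \<le> L" if "p \<in> \<alpha> ` {0..L} \<union> \<beta> ` {0..L}" for p
      using that dist_start by auto
    have close: "\<exists>b\<in>\<beta> ` {0..L}. d a b < R + 1" if "a \<in> \<alpha> ` {0..L}" for a
      by (rule hausdorff_dist_close(1)[OF haus side_subset start start' bounded that])
    have close': "\<exists>a\<in>\<alpha> ` {0..L}. d b a < R + 1" if "b \<in> \<beta> ` {0..L}" for b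
      by (rule hausdorff_dist_close(2)[OF haus side_subset start start' bounded that])
    have "8 * (R + 3) + 2 \<le> real k" unfolding k_def by linarith
    then have long: "4 * (R + 3) \<le> L" using walk_length_le C(2) by linarith
    have "\<exists>t. 0 \<le> t \<and> t \<le> L \<and> d (\<alpha> s) (\<beta> t) < R + 1" if "0 \<le> s" "s \<le> L" for s
      using close[of "\<alpha> s"] that by auto
    moreover have "\<exists>t. 0 \<le> t \<and> t \<le> L \<and> d (\<beta> s) (\<alpha> t) < R + 1" if "0 \<le> s" "s \<le> L" for s
      using close'[of "\<beta> s"] that by auto
    ultimately obtain \<Sigma> where \<Sigma>: "finite \<Sigma>" "\<forall>\<sigma>\<in>\<Sigma>. strict_shortcut V E C \<sigma> \<and> real (walk_length \<sigma>) < R + 2"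
      "dense_subset (3 * R + 9) (trace C) (cycle_dist C) (\<Union>\<sigma>\<in>\<Sigma>. shortcut_vertices \<sigma>)"
      using dense_shortcuts[OF R(1) _ _ long] by blast
    have "walk_length \<sigma> \<le> m" if "\<sigma> \<in> \<Sigma>" for \<sigma>
    proof -
      have "real (walk_length \<sigma>) < R + 2" using \<Sigma>(2) that by blast
      then show ?thesis unfolding m_def by linarith
    qed
    then show "\<exists>\<Sigma>. finite \<Sigma> \<and> (\<forall>\<sigma>\<in>\<Sigma>. strict_shortcut V E C \<sigma> \<and> walk_length \<sigma> \<le> m) \<and>
         dense_subset (3 * R + 9) (trace C) (cycle_dist C) (\<Union>\<sigma>\<in>\<Sigma>. shortcut_vertices \<sigma>)"
      using \<Sigma> by blast
  qed
  then show ?thesis using R(1) by (intro exI[of _ "3 * R + 9"] exI[of _ k] exI[of _ m]) (simp add: k_def)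
qed

end

section \<open>Stability and dense chordality\<close>

theorem theorem6p3:
  fixes V :: "'a set" and E :: "'a set set"
  assumes "connected_graph V E"
  shows "stable_geodesics (graph_points V E) (graph_dist V E) \<longleftrightarrow>
    (\<exists>(\<epsilon>::real) (k::nat) (m::nat). \<epsilon> > 0 \<and> k \<ge> 4 \<and> k \<ge> 2 * m \<and>
      densely_chordal_on V E \<epsilon> k m (bigon_cycles V E))"
proof -
  interpret connected_graph V E by (rule assms)
  show ?thesis using densely_chordal_if_stable stable_if_densely_chordal by blast
qed

end
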